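(* Let $\mathcal{M}$ be a non-zero closed subspace of the real Hardy space $H^2_{\mathbb{R}}(\mathbb{D})$ which is nearly $T_z^*$-invariant with defect $1$, and let the defect space be spanned by a unit vector $e\in H^2_{\mathbb{R}}(\mathbb{D})$. (i) If there exists a function in $\mathcal{M}$ which does not vanish at $0$, then there exists a closed $T_z^*\oplus T_z^*$-invariant subspace $\mathcal{N}\subset H^2_{\mathbb{R}}(\mathbb{D})\oplus H^2_{\mathbb{R}}(\mathbb{D})$ such that $$\mathcal{M}=\{f=gh+zh_1e : (h,h_1)\in\mathcal{N}\},$$ where $g$ is the function of unit norm in $\mathcal{M}$, orthogonal to $\mathcal{M}\cap zH^2_{\mathbb{R}}(\mathbb{D})$, satisfying $g(0)>0$. Further, for all $f=gh+zh_1e\in\mathcal{M}$ with $(h,h_1)\in\mathcal{N}$, $$\|f\|^2=\|h\|^2+\|h_1\|^2.$$ (ii) If all functions in $\mathcal{M}$ vanish at $0$, then there exists a closed $T_z^*$-invariant subspace $\mathcal{N}\subset H^2_{\mathbb{R}}(\mathbb{D})$ such that $$\mathcal{M}=\{f=zh_1e : h_1\in\mathcal{N}\}.$$ Further, for all $f=zh_1e\in\mathcal{M}$ with $h_1\in\mathcal{N}$, $\|f\|=\|h_1\|$.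
   Context: $\mathbb{D}$ is the open unit disc and $H^2(\mathbb{D})$ is the Hardy space of power series $f(z)=\sum_{n\ge 0}a_nz^n$ with $a_n\in\mathbb{C}$ and $\sum|a_n|^2<\infty$, with inner product $\langle \sum a_nz^n,\sum b_nz^n\rangle=\sum a_n\overline{b_n}$. The real Hardy space $H^2_{\mathbb{R}}(\mathbb{D})$ is the set of $f\in H^2(\mathbb{D})$ all of whose coefficients $a_n$ are real; it is a real Hilbert space with the same inner product. "Subspace" of $H^2_{\mathbb{R}}(\mathbb{D})$ (or of a direct sum of copies of it) means closed real-linear subspace. The backward shift on $H^2_{\mathbb{R}}(\mathbb{D})$ is $(T_z^*f)(z)=\frac{f(z)-f(0)}{z}$, and $T_z^*\oplus T_z^*$ acts coordinatewise on the orthogonal direct sum. A subspace $\mathcal{M}$ of $H^2_{\mathbb{R}}(\mathbb{D})$ is nearly $T_z^*$-invariant with (finite) defect if there is a finite-dimensional subspace $\mathcal{F}$ of $H^2_{\mathbb{R}}(\mathbb{D})$, orthogonal to $\mathcal{M}$, such that $T_z^*(\mathcal{M}\cap zH^2_{\mathbb{R}}(\mathbb{D}))\subset\mathcal{M}\oplus\mathcal{F}$. An $\mathcal{F}$ of smallest dimension with this property is called the defect space of $\mathcal{M}$, and its dimension is called the defect of $\mathcal{M}$. *)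

theory Defs
  imports "HOL-Analysis.Analysis"
begin

section \<open>The Hardy space of the disc\<close>

definition hardy :: "complex fps set" where
  "hardy = {f. summable (\<lambda>n. (cmod (fps_nth f n))\<^sup>2)}"

definition hardy_inner :: "complex fps \<Rightarrow> complex fps \<Rightarrow> complex" where
  "hardy_inner f g = (\<Sum>n. fps_nth f n * cnj (fps_nth g n))"

lemma hardy_inner_summable:
  assumes "f \<in> hardy" "g \<in> hardy"
  shows "summable (\<lambda>n. fps_nth f n * cnj (fps_nth g n))"
proof (rule summable_comparison_test')
  show "summable (\<lambda>n. (cmod (fps_nth f n))\<^sup>2 + (cmod (fps_nth g n))\<^sup>2)"
    using assms by (auto simp: hardy_def intro: summable_add)
  fix n :: nat
  have "0 \<le> (cmod (fps_nth f n) - cmod (fps_nth g n))\<^sup>2" by simp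
  moreover have "0 \<le> cmod (fps_nth f n) * cmod (fps_nth g n)" by simp
  ultimately show "norm (fps_nth f n * cnj (fps_nth g n))
      \<le> (cmod (fps_nth f n))\<^sup>2 + (cmod (fps_nth g n))\<^sup>2"
    unfolding norm_mult complex_mod_cnj power2_diff by linarith
qed

lemma hardy_add: "f \<in> hardy \<Longrightarrow> g \<in> hardy \<Longrightarrow> f + g \<in> hardy"
  unfolding hardy_def mem_Collect_eq
proof (rule summable_comparison_test')
  assume f: "summable (\<lambda>n. (cmod (fps_nth f n))\<^sup>2)" and g: "summable (\<lambda>n. (cmod (fps_nth g n))\<^sup>2)"
  show "summable (\<lambda>n. 2 * (cmod (fps_nth f n))\<^sup>2 + 2 * (cmod (fps_nth g n))\<^sup>2)"
    using f g by (intro summable_add summable_mult)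
  fix n :: nat
  have "(cmod (fps_nth (f + g) n))\<^sup>2 \<le> (cmod (fps_nth f n) + cmod (fps_nth g n))\<^sup>2"
    by (simp add: norm_triangle_ineq power_mono)
  moreover have "0 \<le> (cmod (fps_nth f n) - cmod (fps_nth g n))\<^sup>2" by simp
  ultimately show "norm ((cmod (fps_nth (f + g) n))\<^sup>2)
      \<le> 2 * (cmod (fps_nth f n))\<^sup>2 + 2 * (cmod (fps_nth g n))\<^sup>2"
    unfolding power2_diff power2_sum by simp
qed

lemma hardy_cmult: "f \<in> hardy \<Longrightarrow> fps_const c * f \<in> hardy"
  by (auto simp: hardy_def norm_mult power_mult_distrib intro: summable_mult)

lemma hardy_diff: "f \<in> hardy \<Longrightarrow> g \<in> hardy \<Longrightarrow> f - g \<in> hardy"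
  using hardy_add[of f "- g"] by (simp add: hardy_def)

lemma hardy_mult_X: "f \<in> hardy \<Longrightarrow> fps_X * f \<in> hardy"
  using summable_Suc_iff[of "\<lambda>n. (cmod (fps_nth (fps_X * f) n))\<^sup>2"] by (simp add: hardy_def)

lemma hardy_shift: "f \<in> hardy \<Longrightarrow> fps_shift 1 f \<in> hardy"
  using summable_Suc_iff[of "\<lambda>n. (cmod (fps_nth f n))\<^sup>2"] by (simp add: hardy_def)

lemma hardy_conv_radius:
  assumes "f \<in> hardy"
  shows "fps_conv_radius f \<ge> 1"
  unfolding fps_conv_radius_def
proof (rule conv_radius_geI_ex')
  fix r :: real
  assume r: "0 < r" "ereal r < 1"
  show "summable (\<lambda>n. fps_nth f n * of_real r ^ n)"
  proof (rule summable_comparison_test')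
    have "summable (\<lambda>n. (r\<^sup>2) ^ n)"
      using r by (intro summable_geometric) (simp add: power_less_one_iff abs_square_less_1)
    then show "summable (\<lambda>n. (cmod (fps_nth f n))\<^sup>2 + (r\<^sup>2) ^ n)"
      using assms by (auto simp: hardy_def intro: summable_add)
    fix n :: nat
    have "0 \<le> (cmod (fps_nth f n) - r ^ n)\<^sup>2" by simp
    moreover have "0 \<le> cmod (fps_nth f n) * r ^ n" using r by simp
    moreover have "(r ^ n)\<^sup>2 = (r\<^sup>2) ^ n" by (simp add: power_mult [symmetric] mult.commute)
    ultimately have "cmod (fps_nth f n) * r ^ n \<le> (cmod (fps_nth f n))\<^sup>2 + (r\<^sup>2) ^ n"
      unfolding power2_diff by linarith
    then show "norm (fps_nth f n * of_real r ^ n) \<le> (cmod (fps_nth f n))\<^sup>2 + (r\<^sup>2) ^ n"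
      using r by (simp add: norm_mult norm_power)
  qed
qed

section \<open>The real Hardy space\<close>

text \<open>A separate type is used because the library metric on formal power series is not
  the one induced by the Hardy space norm.\<close>

typedef real_hardy = "{f \<in> hardy. \<forall>n. fps_nth f n \<in> \<real>}"
  morphisms fps_of Abs_real_hardy
  by (rule exI[of _ 0]) (simp add: hardy_def)

setup_lifting type_definition_real_hardy

lemma fps_of_hardy [simp]: "fps_of f \<in> hardy"
  using fps_of[of f] by simp

lemma fps_of_Reals [simp]: "fps_nth (fps_of f) n \<in> \<real>"
  using fps_of[of f] by simp

lemma hardy_inner_Reals: "hardy_inner (fps_of f) (fps_of g) \<in> \<real>"
proof -
  have "(\<lambda>n. fps_nth (fps_of f) n * cnj (fps_nth (fps_of g) n)) sums
      hardy_inner (fps_of f) (fps_of g)"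
    unfolding hardy_inner_def by (intro summable_sums hardy_inner_summable) auto
  moreover have "fps_nth (fps_of f) n * cnj (fps_nth (fps_of g) n) \<in> \<real>" for n
    using fps_of_Reals[of f n] fps_of_Reals[of g n]
    unfolding complex_is_Real_iff by simp
  ultimately show ?thesis
    unfolding sums_def
    by (intro Lim_in_closed_set[OF closed_complex_Reals _ sequentially_bot])
       (auto intro!: always_eventually sum_in_Reals)
qed

instantiation real_hardy :: real_vector
begin

lift_definition zero_real_hardy :: real_hardy is 0
  by (simp add: hardy_def)

lift_definition plus_real_hardy :: "real_hardy \<Rightarrow> real_hardy \<Rightarrow> real_hardy" is "(+)"
  by (auto intro: hardy_add)

lift_definition uminus_real_hardy :: "real_hardy \<Rightarrow> real_hardy" is uminus
  by (auto simp: hardy_def)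

lift_definition minus_real_hardy :: "real_hardy \<Rightarrow> real_hardy \<Rightarrow> real_hardy" is "(-)"
  by (auto intro: hardy_diff)

lift_definition scaleR_real_hardy :: "real \<Rightarrow> real_hardy \<Rightarrow> real_hardy"
  is "\<lambda>r f. fps_const (of_real r) * f"
  by (auto intro: hardy_cmult)

instance
proof
  fix f g h :: real_hardy and r s :: real
  show "f + g + h = f + (g + h)" by transfer (simp add: add.assoc)
  show "f + g = g + f" by transfer (simp add: add.commute)
  show "0 + f = f" by transfer simp
  show "- f + f = 0" by transfer simp
  show "f - g = f + - g" by transfer simp
  show "r *\<^sub>R (f + g) = r *\<^sub>R f + r *\<^sub>R g" by transfer (simp add: distrib_left)
  show "(r + s) *\<^sub>R f = r *\<^sub>R f + s *\<^sub>R f"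
    by transfer (simp add: fps_eq_iff distrib_right)
  show "r *\<^sub>R s *\<^sub>R f = (r * s) *\<^sub>R f" by transfer (simp add: fps_eq_iff)
  show "1 *\<^sub>R f = f" by transfer simp
qed

end

text \<open>The library's Hilbert space classes require a real-valued inner product.  On the real
  Hardy space taking the real part loses nothing, by \<open>hardy_inner_Reals\<close>.\<close>

instantiation real_hardy :: real_inner
begin

definition inner_real_hardy :: "real_hardy \<Rightarrow> real_hardy \<Rightarrow> real" where
  "inner_real_hardy f g = Re (hardy_inner (fps_of f) (fps_of g))"

definition norm_real_hardy :: "real_hardy \<Rightarrow> real" where
  "norm_real_hardy f = sqrt (inner f f)"

definition sgn_real_hardy :: "real_hardy \<Rightarrow> real_hardy" where
  "sgn_real_hardy f = f /\<^sub>R norm f"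

definition dist_real_hardy :: "real_hardy \<Rightarrow> real_hardy \<Rightarrow> real" where
  "dist_real_hardy f g = norm (f - g)"

definition uniformity_real_hardy :: "(real_hardy \<times> real_hardy) filter" where
  "uniformity_real_hardy = (INF e\<in>{0 <..}. principal {(f, g). dist f g < e})"

definition open_real_hardy :: "real_hardy set \<Rightarrow> bool" where
  "open_real_hardy U \<longleftrightarrow> (\<forall>f\<in>U. eventually (\<lambda>(f', g). f' = f \<longrightarrow> g \<in> U) uniformity)"

instance
proof
  fix f g h :: real_hardy and r :: real and U :: "real_hardy set"
  note s = hardy_inner_summable[OF fps_of_hardy fps_of_hardy]
  show "dist f g = norm (f - g)" by (rule dist_real_hardy_def)
  show "sgn f = f /\<^sub>R norm f" by (rule sgn_real_hardy_def)
  show "uniformity = (INF e\<in>{0 <..}. principal {(f :: real_hardy, g). dist f g < e})"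
    by (rule uniformity_real_hardy_def)
  show "open U \<longleftrightarrow> (\<forall>f\<in>U. eventually (\<lambda>(f', g). f' = f \<longrightarrow> g \<in> U) uniformity)"
    by (rule open_real_hardy_def)
  show "norm f = sqrt (inner f f)" by (rule norm_real_hardy_def)
  have "hardy_inner (fps_of g) (fps_of f) = cnj (hardy_inner (fps_of f) (fps_of g))"
    using sums_cnj[THEN iffD2, OF summable_sums[OF s[of f g]]]
    by (simp add: hardy_inner_def mult.commute sums_iff)
  then show "inner f g = inner g f"
    by (simp add: inner_real_hardy_def)
  show "inner (f + g) h = inner f h + inner g h"
    unfolding inner_real_hardy_def hardy_inner_def plus_real_hardy.rep_eq
    by (simp add: distrib_right suminf_add[OF s s, symmetric])
  show "inner (r *\<^sub>R f) g = r * inner f g"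
    unfolding inner_real_hardy_def hardy_inner_def scaleR_real_hardy.rep_eq
    by (simp add: mult.assoc suminf_mult[OF s])
  have sq: "summable (\<lambda>n. (cmod (fps_nth (fps_of f) n))\<^sup>2)"
    using fps_of_hardy[of f] by (simp add: hardy_def)
  have "hardy_inner (fps_of f) (fps_of f) = of_real (\<Sum>n. (cmod (fps_nth (fps_of f) n))\<^sup>2)"
    unfolding hardy_inner_def suminf_of_real[OF sq]
    by (simp only: complex_norm_square)
  then have n: "inner f f = (\<Sum>n. (cmod (fps_nth (fps_of f) n))\<^sup>2)"
    by (simp add: inner_real_hardy_def)
  show "0 \<le> inner f f" unfolding n by (rule suminf_nonneg[OF sq]) simp
  have "inner f f = 0 \<longleftrightarrow> (\<forall>n. fps_nth (fps_of f) n = 0)"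
    unfolding n by (subst suminf_eq_zero_iff[OF sq]) auto
  also have "\<dots> \<longleftrightarrow> fps_of f = fps_of 0"
    by (simp add: fps_eq_iff zero_real_hardy.rep_eq)
  finally show "inner f f = 0 \<longleftrightarrow> f = 0" by (simp add: fps_of_inject)
qed

end

abbreviation unit_disc :: "complex set" where
  "unit_disc \<equiv> ball 0 1"

text \<open>Restricting to the disc makes equality of such functions mean equality on the disc,
  also for products that need not lie in the Hardy space.\<close>

definition fun_of :: "real_hardy \<Rightarrow> complex \<Rightarrow> complex" where
  "fun_of f = (\<lambda>z\<in>unit_disc. eval_fps (fps_of f) z)"

section \<open>Shifts and nearly invariant subspaces\<close>

lift_definition mult_z :: "real_hardy \<Rightarrow> real_hardy" is "\<lambda>f. fps_X * f"
  by (auto intro: hardy_mult_X)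

lift_definition backward_shift :: "real_hardy \<Rightarrow> real_hardy" is "fps_shift 1"
  using hardy_shift by auto

lemma fun_of_conv_radius: "z \<in> unit_disc \<Longrightarrow> norm z < fps_conv_radius (fps_of f)"
  using hardy_conv_radius[OF fps_of_hardy[of f]]
  by (metis ereal_less(3) less_le_trans mem_ball_0)

lemma fun_of_sums:
  "z \<in> unit_disc \<Longrightarrow> (\<lambda>n. fps_nth (fps_of f) n * z ^ n) sums fun_of f z"
  by (simp add: fun_of_def sums_eval_fps fun_of_conv_radius)

lemma fun_of_mult_z: "z \<in> unit_disc \<Longrightarrow> fun_of (mult_z f) z = z * fun_of f z"
  using fun_of_conv_radius[of z f]
  by (simp add: fun_of_def mult_z.rep_eq eval_fps_mult)

lemma fun_of_backward_shift:
  assumes "z \<in> unit_disc" "z \<noteq> 0"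
  shows "fun_of (backward_shift f) z = (fun_of f z - fun_of f 0) / z"
proof -
  have "(\<lambda>n. fps_nth (fps_of f) (Suc n) * z ^ Suc n) sums (fun_of f z - fun_of f 0)"
    using fun_of_sums[OF assms(1), of f] sums_Suc_iff[of "\<lambda>n. fps_nth (fps_of f) n * z ^ n"]
    by (simp add: fun_of_def eval_fps_at_0)
  then have "(\<lambda>n. fps_nth (fps_of f) (Suc n) * z ^ Suc n / z) sums
      ((fun_of f z - fun_of f 0) / z)"
    by (rule sums_divide)
  moreover have "fps_nth (fps_of f) (Suc n) * z ^ Suc n / z
      = fps_nth (fps_of (backward_shift f)) n * z ^ n" for n
    using assms by (simp add: backward_shift.rep_eq)
  ultimately show ?thesis
    using fun_of_sums[OF assms(1), of "backward_shift f"] by (simp add: sums_unique2)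
qed

definition admits_defect :: "real_hardy set \<Rightarrow> real_hardy set \<Rightarrow> bool" where
  "admits_defect M F \<longleftrightarrow>
     subspace F \<and> (\<exists>B. finite B \<and> F \<subseteq> span B) \<and>
     (\<forall>m\<in>M. \<forall>f\<in>F. orthogonal m f) \<and>
     backward_shift ` (M \<inter> range mult_z) \<subseteq> {m + f | m f. m \<in> M \<and> f \<in> F}"

definition nearly_invariant :: "real_hardy set \<Rightarrow> bool" where
  "nearly_invariant M \<longleftrightarrow> (\<exists>F. admits_defect M F)"

text \<open>The \<open>LEAST\<close> is meaningful only for nearly invariant \<open>M\<close>.\<close>

definition defect :: "real_hardy set \<Rightarrow> nat" where
  "defect M = (LEAST d. \<exists>F. admits_defect M F \<and> dim F = d)"

definition is_defect_space :: "real_hardy set \<Rightarrow> real_hardy set \<Rightarrow> bool" where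
  "is_defect_space M F \<longleftrightarrow> admits_defect M F \<and> dim F = defect M"

end

theory Submission
  imports Defs
begin

text \<open>
  Let \<open>f\<close> be in \<open>M\<close>.  Subtracting its component along \<open>g\<close> leaves a function in \<open>M\<close> that vanishes at \<open>0\<close>.
  By near invariance its backward shift is a sum of some \<open>T f\<close> in \<open>M\<close> and a multiple \<open>b f\<close> of \<open>e\<close>, so
  \<open>f = inner f g *\<^sub>R g + z (T f) + b f *\<^sub>R (z e)\<close>, and by orthogonality
  \<open>(norm f)\<^sup>2 = (inner f g)\<^sup>2 + (b f)\<^sup>2 + (norm (T f))\<^sup>2\<close>.  Iteration suggests the Taylor coefficients
  \<open>inner ((T ^^ n) f) g\<close> for \<open>h\<close> and \<open>b ((T ^^ n) f)\<close> for \<open>h1\<close>; the identity \<open>f = g h + z h1 e\<close> then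
  holds coefficient by coefficient (\<open>factorization\<close>).  The space \<open>N\<close> is the image of \<open>M\<close> under
  \<open>f \<mapsto> (h, h1)\<close>.  It is invariant because this map turns \<open>T\<close> into the backward shift.  It is closed
  because the map is isometric, and that is also the norm formula of the theorem.  If all
  functions in \<open>M\<close> vanish at \<open>0\<close>, the same argument applies with \<open>g = 0\<close>.

  The isometry amounts to \<open>(T ^^ n) f \<longlonglongrightarrow> 0\<close>, and this is the core of the proof
  (\<open>orbit_tendsto_0\<close>).  Extended to the whole Hardy space by its formula, \<open>T\<close> is a contraction that
  differs from the backward shift by an operator of finite rank, and the assertion is that such
  a perturbation does not create vectors whose norm survives under all iterates.  For vectors in
  the range of \<open>I - T T'\<close>, where \<open>T'\<close> is the adjoint, the orbit is square summable against every
  vector, and an estimate in the spirit of Kato and Rosenblum shows that the orbit tends to \<open>0\<close>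
  (\<open>orbit_tendsto_0_on_defect_range\<close>).  On the orthogonal complement of the set of all vectors with
  orbits tending to \<open>0\<close>, the operator \<open>T\<close> is then isometric, so that the energy balance leaves only
  \<open>y = z (T y)\<close>; a vector in this complement is divisible by every power of \<open>z\<close> and is therefore \<open>0\<close>.
\<close>

section \<open>Orthogonal projection in a Hilbert space\<close>

text \<open>If \<open>z\<close> comes within \<open>\<epsilon>\<^sup>2\<close> of the infimum of the squared distance, then moving \<open>z\<close> in the direction
  \<open>w\<close> gains at most \<open>\<epsilon>\<^sup>2\<close>.  The best such move gains \<open>(inner (x - z) w)\<^sup>2 / (norm w)\<^sup>2\<close>.\<close>

lemma almost_orthogonal_approximation:
  fixes x :: "'a :: real_inner"
  assumes Z: "subspace Z" and "\<epsilon> > 0"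
  shows "\<exists>z\<in>Z. \<forall>w\<in>Z. \<bar>inner (x - z) w\<bar> \<le> \<epsilon> * norm w"
proof -
  define D where "D = (\<lambda>z. (norm (x - z))\<^sup>2) ` Z"
  have "D \<noteq> {}" using subspace_0[OF Z] by (auto simp: D_def)
  moreover have "bdd_below D" by (rule bdd_belowI[of _ 0]) (auto simp: D_def)
  moreover have "Inf D < Inf D + \<epsilon>\<^sup>2" using \<open>\<epsilon> > 0\<close> by simp
  ultimately have "\<exists>d\<in>D. d < Inf D + \<epsilon>\<^sup>2" by (intro cInf_lessD)
  then obtain z where z: "z \<in> Z" "(norm (x - z))\<^sup>2 < Inf D + \<epsilon>\<^sup>2"
    by (auto simp: D_def)
  have "\<bar>inner (x - z) w\<bar> \<le> \<epsilon> * norm w" if w: "w \<in> Z" for w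
  proof (cases "w = 0")
    case False
    \<comment> \<open>the step length that minimises the distance from \<open>x\<close> along the line through \<open>z\<close>\<close>
    define t where "t = inner (x - z) w / (norm w)\<^sup>2"
    have "z + t *\<^sub>R w \<in> Z" using z w Z by (simp add: subspace_add subspace_scale)
    then have "Inf D \<le> (norm (x - (z + t *\<^sub>R w)))\<^sup>2"
      by (intro cInf_lower \<open>bdd_below D\<close>) (auto simp: D_def)
    also have "\<dots> = (norm (x - z))\<^sup>2 - 2 * t * inner (x - z) w + t\<^sup>2 * (norm w)\<^sup>2"
      unfolding power2_norm_eq_inner
      by (simp add: inner_diff inner_add inner_commute algebra_simps power2_eq_square)
    also have "\<dots> = (norm (x - z))\<^sup>2 - (inner (x - z) w)\<^sup>2 / (norm w)\<^sup>2"
      using False by (simp add: t_def field_simps power2_eq_square)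
    finally have "(inner (x - z) w)\<^sup>2 / (norm w)\<^sup>2 \<le> \<epsilon>\<^sup>2" using z by simp
    then have "(inner (x - z) w)\<^sup>2 \<le> (\<epsilon> * norm w)\<^sup>2"
      using False by (simp add: field_simps)
    then show ?thesis
      using \<open>\<epsilon> > 0\<close> by (metis abs_le_square_iff abs_of_nonneg less_imp_le mult_nonneg_nonneg norm_ge_zero)
  qed simp
  with z show ?thesis by blast
qed

text \<open>Approximations with \<open>\<epsilon> \<longlonglongrightarrow> 0\<close> form a Cauchy sequence, because testing the residuals of two of
  them against their difference bounds that difference.\<close>

lemma orthogonal_projection_exists:
  fixes x :: "'a :: {real_inner, complete_space}"
  assumes Z: "subspace Z" "closed Z"
  shows "\<exists>z\<in>Z. \<forall>w\<in>Z. inner (x - z) w = 0"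
proof -
  define \<epsilon> where "\<epsilon> n = inverse (real (Suc n))" for n
  have pos: "\<epsilon> n > 0" for n by (simp add: \<epsilon>_def)
  have "\<forall>n. \<exists>z. z \<in> Z \<and> (\<forall>w\<in>Z. \<bar>inner (x - z) w\<bar> \<le> \<epsilon> n * norm w)"
    using almost_orthogonal_approximation[OF Z(1) pos] by blast
  then obtain z where z: "\<And>n. z n \<in> Z"
    and ortho: "\<And>n w. w \<in> Z \<Longrightarrow> \<bar>inner (x - z n) w\<bar> \<le> \<epsilon> n * norm w"
    by metis
  have dist: "dist (z m) (z n) \<le> \<epsilon> m + \<epsilon> n" for m n
  proof -
    define w where "w = z m - z n"
    have w: "w \<in> Z" using z Z by (simp add: w_def subspace_diff)
    have "(norm w)\<^sup>2 = inner (x - z n) w - inner (x - z m) w"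
      by (simp add: w_def power2_norm_eq_inner inner_diff)
    also have "\<dots> \<le> (\<epsilon> m + \<epsilon> n) * norm w"
      using ortho[OF w, of m] ortho[OF w, of n] by (simp add: algebra_simps)
    finally have "norm w * norm w \<le> (\<epsilon> m + \<epsilon> n) * norm w" by (simp add: power2_eq_square)
    then have "norm w \<le> \<epsilon> m + \<epsilon> n"
      using pos[of m] pos[of n] by (cases "w = 0") auto
    then show ?thesis by (simp add: dist_norm w_def)
  qed
  have lim0: "\<epsilon> \<longlonglongrightarrow> 0" unfolding \<epsilon>_def by (rule LIMSEQ_inverse_real_of_nat)
  have "Cauchy z"
  proof (rule metric_CauchyI)
    fix r :: real assume "r > 0"
    then have "eventually (\<lambda>n. \<epsilon> n < r / 2) sequentially"
      using lim0 by (intro order_tendstoD(2)[where y = 0]) auto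
    then obtain N where "\<And>n. n \<ge> N \<Longrightarrow> \<epsilon> n < r / 2"
      by (auto simp: eventually_sequentially)
    then show "\<exists>N. \<forall>m\<ge>N. \<forall>n\<ge>N. dist (z m) (z n) < r"
      using dist by (smt (verit, best) field_sum_of_halves)
  qed
  then obtain l where l: "z \<longlonglongrightarrow> l" using Cauchy_convergent_iff convergent_def by blast
  have "l \<in> Z" using closed_sequentially[OF Z(2)] z l by blast
  moreover have "inner (x - l) w = 0" if w: "w \<in> Z" for w
  proof (rule LIMSEQ_unique)
    show "(\<lambda>n. inner (x - z n) w) \<longlonglongrightarrow> inner (x - l) w" by (intro tendsto_intros l)
    have "(\<lambda>n. \<epsilon> n * norm w) \<longlonglongrightarrow> 0" using tendsto_mult_left_zero[OF lim0] by simp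
    then show "(\<lambda>n. inner (x - z n) w) \<longlonglongrightarrow> 0"
      by (rule Lim_null_comparison[rotated]) (use ortho[OF w] in auto)
  qed
  ultimately show ?thesis by blast
qed

section \<open>Iterates and adjoints of contractions\<close>

lemma adjoint_contraction:
  fixes F F' :: "'a :: real_inner \<Rightarrow> 'a"
  assumes "\<And>x y. inner (F x) y = inner x (F' y)" and "\<And>x. norm (F x) \<le> norm x"
  shows "norm (F' y) \<le> norm y"
proof -
  have "(norm (F' y))\<^sup>2 = inner (F (F' y)) y" by (simp add: assms(1) power2_norm_eq_inner)
  also have "\<dots> \<le> norm (F (F' y)) * norm y" by (rule norm_cauchy_schwarz)
  also have "\<dots> \<le> norm (F' y) * norm y" by (intro mult_right_mono assms) auto
  finally have "norm (F' y) * norm (F' y) \<le> norm y * norm (F' y)" by (simp add: power2_eq_square mult.commute)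
  then show ?thesis by (cases "F' y = 0") auto
qed

lemma norm_funpow_le:
  fixes F :: "'a :: real_normed_vector \<Rightarrow> 'a"
  assumes "\<And>x. norm (F x) \<le> norm x"
  shows "norm ((F ^^ n) x) \<le> norm x"
proof (induction n)
  case (Suc n)
  then show ?case using order_trans[OF assms[of "(F ^^ n) x"]] by simp
qed simp

lemma adjoint_funpow:
  fixes F F' :: "'a :: real_inner \<Rightarrow> 'a"
  assumes "\<And>x y. inner (F x) y = inner x (F' y)"
  shows "inner ((F ^^ n) x) y = inner x ((F' ^^ n) y)"
  by (induction n arbitrary: y) (simp_all add: assms funpow_swap1[of F'])

lemma linear_funpow:
  fixes F :: "'a :: real_vector \<Rightarrow> 'a"
  shows "linear F \<Longrightarrow> linear (F ^^ n)"
proof (induction n)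
  case (Suc n)
  then show ?case using linear_compose[of "F ^^ n" F] by (simp add: o_def)
qed (simp add: linear_id[unfolded id_def] id_def)

section \<open>Finite-rank perturbations of a backward shift\<close>

text \<open>The operator \<open>T\<close> is the adjoint \<open>B\<close> of the isometry \<open>S\<close>, modified by an operator of finite
  rank: applying \<open>B\<close> to \<open>decomposition\<close> gives \<open>B x = T x + (\<Sum>i\<in>I. inner x (p i) *\<^sub>R B (q i))\<close>.
  By \<open>energy\<close> the same vectors \<open>p i\<close> account for all the norm that \<open>T\<close> loses, so along an orbit
  the coefficients \<open>inner ((T ^^ n) x) (p i)\<close> are square summable.  The aim of this part is
  that \<open>T\<close>, like \<open>B\<close>, has iterates that tend to \<open>0\<close> at every vector.\<close>

locale perturbed_backward_shift =
  fixes S B T T' :: "'a :: {real_inner, complete_space} \<Rightarrow> 'a"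
    and I :: "'i set" and p q :: "'i \<Rightarrow> 'a"
  assumes lin_S: "linear S" and lin_T: "linear T"
    and adj_S: "\<And>x y. inner (S x) y = inner x (B y)"
    and adj_T: "\<And>x y. inner (T x) y = inner x (T' y)"
    and isometry: "\<And>x. norm (S x) = norm x"
    and B_stable: "\<And>x. (\<lambda>n. (B ^^ n) x) \<longlonglongrightarrow> 0"
    and finite_I: "finite I"
    and decomposition: "\<And>x. x = S (T x) + (\<Sum>i\<in>I. inner x (p i) *\<^sub>R q i)"
    and energy: "\<And>x. (norm x)\<^sup>2 = (norm (T x))\<^sup>2 + (\<Sum>i\<in>I. (inner x (p i))\<^sup>2)"
begin

lemma contraction: "norm (T x) \<le> norm x"
proof -
  have "(norm (T x))\<^sup>2 \<le> (norm x)\<^sup>2"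
    unfolding energy[of x] by (simp add: sum_nonneg)
  then show ?thesis by simp
qed

lemma T'_contraction: "norm (T' y) \<le> norm y"
  by (rule adjoint_contraction[OF adj_T contraction])

lemma B_contraction: "norm (B y) \<le> norm y"
  by (rule adjoint_contraction[OF adj_S]) (simp add: isometry)

lemma norm_funpow_S: "norm ((S ^^ k) u) = norm u"
  by (induction k) (auto simp: isometry)

text \<open>Vectors in the range of \<open>I - T T'\<close> have orbits that are square summable against every fixed
  vector, with a uniform bound: moving \<open>T ^^ j\<close> and \<open>I - T T'\<close> to the other side leaves the norms of
  \<open>(I - T T') ((T' ^^ j) v)\<close>, and the square of such a norm is at most what \<open>T'\<close> takes away from
  \<open>(norm ((T' ^^ j) v))\<^sup>2\<close>, so that the sum telescopes.\<close>

lemma orbit_square_sum: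
  assumes "x = y - T (T' y)"
  shows "(\<Sum>j\<in>{m..<n}. (inner ((T ^^ j) x) v)\<^sup>2) \<le> (norm y * norm v)\<^sup>2"
proof -
  have term_bound: "(inner ((T ^^ j) x) v)\<^sup>2
      \<le> (norm y)\<^sup>2 * ((norm ((T' ^^ j) v))\<^sup>2 - (norm ((T' ^^ Suc j) v))\<^sup>2)" for j
  proof -
    define w where "w = (T' ^^ j) v"
    have "inner ((T ^^ j) x) v = inner (y - T (T' y)) w"
      by (simp add: w_def adjoint_funpow[OF adj_T] assms)
    also have "\<dots> = inner y (w - T (T' w))"
      by (simp add: inner_diff adj_T) (metis adj_T inner_commute)
    finally have "(inner ((T ^^ j) x) v)\<^sup>2 \<le> (norm y)\<^sup>2 * (norm (w - T (T' w)))\<^sup>2"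
      using Cauchy_Schwarz_ineq[of y "w - T (T' w)"] by (simp add: power2_norm_eq_inner)
    also have "(norm (w - T (T' w)))\<^sup>2 = (norm w)\<^sup>2 - 2 * (norm (T' w))\<^sup>2 + (norm (T (T' w)))\<^sup>2"
      by (simp add: power2_norm_eq_inner inner_diff inner_commute[of w "T (T' w)"] adj_T[of "T' w" w])
    also have "\<dots> \<le> (norm w)\<^sup>2 - (norm (T' w))\<^sup>2"
      using contraction[of "T' w"] by (simp add: power_mono)
    finally show ?thesis by (simp add: w_def mult_left_mono)
  qed
  have "(\<Sum>j\<in>{m..<n}. (inner ((T ^^ j) x) v)\<^sup>2)
      \<le> (\<Sum>j\<in>{..<n}. (inner ((T ^^ j) x) v)\<^sup>2)"
    by (intro sum_mono2) auto
  also have "\<dots> \<le> (\<Sum>j<n. (norm y)\<^sup>2 * ((norm ((T' ^^ j) v))\<^sup>2 - (norm ((T' ^^ Suc j) v))\<^sup>2))"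
    by (intro sum_mono term_bound)
  also have "\<dots> = (norm y)\<^sup>2 * ((norm v)\<^sup>2 - (norm ((T' ^^ n) v))\<^sup>2)"
    unfolding sum_distrib_left[symmetric] by (subst sum_lessThan_telescope') simp
  also have "\<dots> \<le> (norm y * norm v)\<^sup>2"
    by (simp add: power_mult_distrib mult_left_mono)
  finally show ?thesis .
qed

text \<open>The quadratic form \<open>transfer k\<close> compares \<open>x\<close> with \<open>(S ^^ k) ((T ^^ k) x)\<close>, which is what is left
  of \<open>x\<close> after \<open>decomposition\<close> is applied \<open>k\<close> times.  It has different limits in two directions: for
  fixed \<open>x\<close> it tends to \<open>0\<close> in \<open>k\<close>, and for fixed \<open>k\<close> it approaches the squared norm along an orbit
  of \<open>T\<close>.\<close>

definition transfer :: "nat \<Rightarrow> 'a \<Rightarrow> real" where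
  "transfer k x = inner ((S ^^ k) ((T ^^ k) x)) x"

text \<open>Both slots of the inner product are expanded by \<open>decomposition\<close>, and \<open>S\<close> cancels because it is
  an isometry.  Each remaining term is a product of a square summable coefficient and a second
  factor that \<open>orbit_square_sum\<close> can control.\<close>

lemma transfer_step:
  "transfer k x - transfer k (T x) =
     (\<Sum>i\<in>I. inner x (p i) * inner ((S ^^ k) ((T ^^ k) x)) (q i)) +
     (\<Sum>i\<in>I. inner ((T ^^ k) x) (p i) * inner ((S ^^ k) (q i)) (S (T x)))"
proof -
  have "transfer k x = inner ((S ^^ k) ((T ^^ k) x)) (S (T x)) +
      (\<Sum>i\<in>I. inner x (p i) * inner ((S ^^ k) ((T ^^ k) x)) (q i))"
    unfolding transfer_def by (subst (3) decomposition) (simp add: inner_add_right inner_sum_right)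
  moreover have "inner ((S ^^ k) ((T ^^ k) x)) (S (T x)) = transfer k (T x) +
      (\<Sum>i\<in>I. inner ((T ^^ k) x) (p i) * inner ((S ^^ k) (q i)) (S (T x)))"
  proof -
    note lin = linear_funpow[OF lin_S, of k]
    have "(S ^^ k) ((T ^^ k) x) = S ((S ^^ k) ((T ^^ k) (T x))) +
        (\<Sum>i\<in>I. inner ((T ^^ k) x) (p i) *\<^sub>R (S ^^ k) (q i))"
      by (subst decomposition[of "(T ^^ k) x"])
         (simp add: linear_add[OF lin] linear_sum[OF lin] linear_scale[OF lin] funpow_swap1)
    moreover have "inner (S u) (S v) = inner u v" for u v
    proof -
      have "(norm (S (u + v)))\<^sup>2 = (norm (u + v))\<^sup>2" by (simp add: isometry)
      then show ?thesis
        using isometry[of u] isometry[of v]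
        by (simp add: linear_add[OF lin_S] dot_norm)
    qed
    ultimately show ?thesis
      by (simp add: transfer_def inner_add_left inner_sum_left)
  qed
  ultimately show ?thesis by simp
qed

text \<open>\<open>S ^^ k\<close> moves to the other side as \<open>B ^^ k\<close>, which tends to \<open>0\<close> at \<open>x\<close>.\<close>

lemma transfer_tendsto_0: "(\<lambda>k. transfer k x) \<longlonglongrightarrow> 0"
proof (rule Lim_null_comparison)
  show "(\<lambda>k. norm x * norm ((B ^^ k) x)) \<longlonglongrightarrow> 0"
    using tendsto_mult_right_zero[OF tendsto_norm_zero[OF B_stable]] by simp
  have "\<bar>transfer k x\<bar> \<le> norm x * norm ((B ^^ k) x)" for k
  proof -
    have "\<bar>transfer k x\<bar> \<le> norm ((T ^^ k) x) * norm ((B ^^ k) x)"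
      unfolding transfer_def adjoint_funpow[OF adj_S] by (rule Cauchy_Schwarz_ineq2)
    also have "\<dots> \<le> norm x * norm ((B ^^ k) x)"
      by (intro mult_right_mono norm_funpow_le contraction) auto
    finally show ?thesis .
  qed
  then show "eventually (\<lambda>k. norm (transfer k x) \<le> norm x * norm ((B ^^ k) x)) sequentially"
    by simp
qed

lemma energy_sum:
  "(\<Sum>j\<in>{m..<m + d}. \<Sum>i\<in>I. (inner ((T ^^ j) x) (p i))\<^sup>2)
     = (norm ((T ^^ m) x))\<^sup>2 - (norm ((T ^^ (m + d)) x))\<^sup>2"
proof (induction d)
  case (Suc d)
  then show ?case using energy[of "(T ^^ (m + d)) x"] by simp
qed simp

lemma decseq_orbit: "decseq (\<lambda>n. norm ((T ^^ n) x))"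
  by (rule decseq_SucI) (simp add: contraction)

lemma orbit_norm_convergent:
  obtains \<delta> where "\<delta> \<ge> 0" "(\<lambda>n. (norm ((T ^^ n) x))\<^sup>2) \<longlonglongrightarrow> \<delta>"
    "\<And>n. \<delta> \<le> (norm ((T ^^ n) x))\<^sup>2"
proof -
  have dec: "decseq (\<lambda>n. (norm ((T ^^ n) x))\<^sup>2)"
    using decseq_orbit[of x] by (auto simp: decseq_def intro: power_mono)
  obtain \<delta> where "(\<lambda>n. (norm ((T ^^ n) x))\<^sup>2) \<longlonglongrightarrow> \<delta>" "\<And>n. \<delta> \<le> (norm ((T ^^ n) x))\<^sup>2"
    by (rule decseq_convergent[OF dec, of 0]) auto
  moreover then have "\<delta> \<ge> 0" by (intro LIMSEQ_le_const[of _ \<delta> 0]) auto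
  ultimately show thesis using that by blast
qed

text \<open>By \<open>energy\<close> the coefficients in \<open>decomposition\<close> tend to \<open>0\<close> along an orbit, since the norms
  converge.  Hence so does the error of \<open>k\<close> expansions, for each fixed \<open>k\<close>.\<close>

lemma transfer_along_orbit:
  "(\<lambda>n. transfer k ((T ^^ n) x) - (norm ((T ^^ n) x))\<^sup>2) \<longlonglongrightarrow> 0"
proof -
  define x' where "x' n = (T ^^ n) x" for n
  \<comment> \<open>the error after \<open>k\<close> expansions at the \<open>n\<close>-th point of the orbit\<close>
  define R where "R k n = x' n - (S ^^ k) (x' (n + k))" for k n
  obtain \<delta> where \<delta>: "(\<lambda>n. (norm (x' n))\<^sup>2) \<longlonglongrightarrow> \<delta>"
    using orbit_norm_convergent[of x] unfolding x'_def by blast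
  have R1: "(\<lambda>n. x' n - S (x' (Suc n))) \<longlonglongrightarrow> 0"
  proof -
    have "(\<lambda>n. inner (x' n) (p i)) \<longlonglongrightarrow> 0" if i: "i \<in> I" for i
    proof -
      have "(\<lambda>n. (inner (x' n) (p i))\<^sup>2) \<longlonglongrightarrow> 0"
      proof (rule Lim_null_comparison)
        show "(\<lambda>n. (norm (x' n))\<^sup>2 - (norm (x' (Suc n)))\<^sup>2) \<longlonglongrightarrow> 0"
          using tendsto_diff[OF \<delta> LIMSEQ_Suc[OF \<delta>]] by simp
        have "(inner (x' n) (p i))\<^sup>2 \<le> (norm (x' n))\<^sup>2 - (norm (x' (Suc n)))\<^sup>2" for n
          using energy[of "x' n"] member_le_sum[OF i _ finite_I, of "\<lambda>i. (inner (x' n) (p i))\<^sup>2"]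
          by (simp add: x'_def)
        then show "eventually (\<lambda>n. norm ((inner (x' n) (p i))\<^sup>2)
            \<le> (norm (x' n))\<^sup>2 - (norm (x' (Suc n)))\<^sup>2) sequentially" by simp
      qed
      then show ?thesis by simp
    qed
    then have "(\<lambda>n. \<Sum>i\<in>I. inner (x' n) (p i) *\<^sub>R q i) \<longlonglongrightarrow> (\<Sum>i\<in>I. 0 *\<^sub>R q i)"
      by (intro tendsto_intros)
    moreover have "x' n - S (x' (Suc n)) = (\<Sum>i\<in>I. inner (x' n) (p i) *\<^sub>R q i)" for n
      using decomposition[of "x' n"] by (simp add: x'_def algebra_simps)
    ultimately show ?thesis by simp
  qed
  have R: "R k \<longlonglongrightarrow> 0" for k
  proof (induction k)
    case (Suc k)
    have "R (Suc k) n = R k n + (S ^^ k) (x' (n + k) - S (x' (Suc (n + k))))" for n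
      by (simp add: R_def linear_diff[OF linear_funpow[OF lin_S]] funpow_swap1)
    moreover have "(\<lambda>n. (S ^^ k) (x' (n + k) - S (x' (Suc (n + k))))) \<longlonglongrightarrow> 0"
      by (rule tendsto_norm_zero_cancel)
         (simp add: norm_funpow_S tendsto_norm_zero[OF LIMSEQ_ignore_initial_segment[OF R1, of k]])
    ultimately show ?case using tendsto_add[OF Suc] by (simp add: fun_eq_iff)
  qed (simp add: R_def)
  have bound: "\<bar>transfer k (x' n) - (norm (x' n))\<^sup>2\<bar> \<le> norm (R k n) * norm x" for n
  proof -
    have "transfer k (x' n) - (norm (x' n))\<^sup>2 = - inner (R k n) (x' n)"
      by (simp add: transfer_def R_def x'_def power2_norm_eq_inner inner_diff funpow_add add.commute[of n k]
          flip: funpow_swap1)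
    also have "\<bar>\<dots>\<bar> \<le> norm (R k n) * norm (x' n)"
      by (simp add: Cauchy_Schwarz_ineq2)
    also have "\<dots> \<le> norm (R k n) * norm x"
      unfolding x'_def by (intro mult_left_mono norm_funpow_le contraction) auto
    finally show ?thesis .
  qed
  show ?thesis
  proof (rule Lim_null_comparison)
    show "(\<lambda>n. norm (R k n) * norm x) \<longlonglongrightarrow> 0"
      using tendsto_mult_left_zero[OF tendsto_norm_zero[OF R]] by simp
  qed (use bound in \<open>simp add: x'_def\<close>)
qed

text \<open>This is the idea behind the Kato--Rosenblum theorem on trace class perturbations.  Let \<open>\<delta>\<close> be the
  limit of \<open>(norm ((T ^^ n) x))\<^sup>2\<close>.  The form \<open>transfer k\<close> changes along the orbit, from index \<open>m\<close> on,
  by a sum of products to which the Cauchy--Schwarz inequality in the orbit index applies: one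
  factor is the tail of the energy series, of size \<open>sqrt ((norm ((T ^^ m) x))\<^sup>2 - \<delta>)\<close>, and the other
  is bounded by \<open>orbit_square_sum\<close>, uniformly in \<open>k\<close>.  Letting the orbit index tend to infinity, and
  only then \<open>k\<close>, turns \<open>transfer k\<close> at the two ends into \<open>\<delta>\<close> and \<open>0\<close>.  So \<open>\<delta>\<close> is bounded by a
  quantity that tends to \<open>0\<close> with \<open>m\<close>.\<close>

lemma orbit_tendsto_0_on_defect_range:
  assumes x: "x = y - T (T' y)"
  shows "(\<lambda>n. (T ^^ n) x) \<longlonglongrightarrow> 0"
proof -
  obtain \<delta> where "\<delta> \<ge> 0" and lim: "(\<lambda>n. (norm ((T ^^ n) x))\<^sup>2) \<longlonglongrightarrow> \<delta>"
    and le: "\<And>n. \<delta> \<le> (norm ((T ^^ n) x))\<^sup>2"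
    using orbit_norm_convergent[of x] by blast
  define Q where "Q = (\<Sum>i\<in>I. norm (q i))"
  define \<eta> where "\<eta> m = sqrt ((norm ((T ^^ m) x))\<^sup>2 - \<delta>)" for m
  have coeff: "L2_set (\<lambda>j. inner ((T ^^ (k + j)) x) (p i)) {m..<n} \<le> \<eta> m" if i: "i \<in> I" for i m n k
  proof -
    have "(\<Sum>j\<in>{m..<n}. (inner ((T ^^ (k + j)) x) (p i))\<^sup>2)
        = (\<Sum>j\<in>{m+k..<n+k}. (inner ((T ^^ j) x) (p i))\<^sup>2)"
      by (subst sum.shift_bounds_nat_ivl) (simp add: add.commute)
    also have "\<dots> \<le> (\<Sum>j\<in>{m+k..<(m+k)+(n-m)}. \<Sum>i\<in>I. (inner ((T ^^ j) x) (p i))\<^sup>2)"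
      by (intro order_trans[OF sum_mono sum_mono2] member_le_sum i finite_I) (auto intro: sum_nonneg)
    also have "\<dots> \<le> (norm ((T ^^ (m+k)) x))\<^sup>2 - \<delta>"
      unfolding energy_sum using le by simp
    also have "\<dots> \<le> (norm ((T ^^ m) x))\<^sup>2 - \<delta>"
      using decseqD[OF decseq_orbit, of m "m + k" x] by (simp add: power_mono)
    finally show ?thesis by (simp add: L2_set_def \<eta>_def real_sqrt_le_mono)
  qed
  have orbit: "L2_set (\<lambda>j. inner ((T ^^ j) x) v) {m..<n} \<le> norm y * norm (q i)"
    if "norm v \<le> norm (q i)" for v m n i
  proof -
    have "L2_set (\<lambda>j. inner ((T ^^ j) x) v) {m..<n} \<le> norm y * norm v"
      unfolding L2_set_def by (rule real_le_lsqrt) (auto intro: orbit_square_sum x sum_nonneg)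
    also have "\<dots> \<le> norm y * norm (q i)" by (intro mult_left_mono that) auto
    finally show ?thesis .
  qed
  have product: "(\<Sum>j\<in>{m..<n}. \<Sum>i\<in>I. inner ((T ^^ (k + j)) x) (p i) * inner ((T ^^ j) x) (v i))
      \<ge> - (\<eta> m * norm y * Q)" if v: "\<And>i. norm (v i) \<le> norm (q i)" for m n k v
  proof -
    have "\<bar>\<Sum>j\<in>{m..<n}. inner ((T ^^ (k + j)) x) (p i) * inner ((T ^^ j) x) (v i)\<bar>
        \<le> \<eta> m * (norm y * norm (q i))" if i: "i \<in> I" for i
    proof -
      have "\<bar>\<Sum>j\<in>{m..<n}. inner ((T ^^ (k + j)) x) (p i) * inner ((T ^^ j) x) (v i)\<bar>
        \<le> (\<Sum>j\<in>{m..<n}. \<bar>inner ((T ^^ (k + j)) x) (p i)\<bar> * \<bar>inner ((T ^^ j) x) (v i)\<bar>)"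
        by (rule order_trans[OF sum_abs]) (simp add: abs_mult)
      also have "\<dots> \<le> L2_set (\<lambda>j. inner ((T ^^ (k + j)) x) (p i)) {m..<n}
            * L2_set (\<lambda>j. inner ((T ^^ j) x) (v i)) {m..<n}"
        by (rule L2_set_mult_ineq)
      also have "\<dots> \<le> \<eta> m * (norm y * norm (q i))"
        by (rule mult_mono[OF coeff[OF i] orbit[OF v]]) (simp_all add: \<eta>_def le)
      finally show ?thesis .
    qed
    then have "(\<Sum>i\<in>I. - (\<eta> m * (norm y * norm (q i))))
        \<le> (\<Sum>i\<in>I. \<Sum>j\<in>{m..<n}. inner ((T ^^ (k + j)) x) (p i) * inner ((T ^^ j) x) (v i))"
      by (intro sum_mono) (simp only: abs_le_iff minus_le_iff)
    then show ?thesis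
      by (subst sum.swap) (simp add: Q_def sum_distrib_left sum_negf mult.assoc)
  qed
  have transfer_diff: "transfer k ((T ^^ n) x) - transfer k ((T ^^ m) x) \<le> 2 * (\<eta> m * norm y * Q)"
    if "m \<le> n" for k m n
  proof -
    \<comment> \<open>the vectors that the orbit is tested against once all other operators have been moved\<close>
    let ?v = "\<lambda>i. (T' ^^ k) ((B ^^ k) (q i))" and ?w = "\<lambda>i. T' (B ((S ^^ k) (q i)))"
    have v: "norm (?v i) \<le> norm (q i)" for i
      by (intro order_trans[OF norm_funpow_le] norm_funpow_le T'_contraction B_contraction)
    have w: "norm (?w i) \<le> norm (q i)" for i
      using order_trans[OF T'_contraction B_contraction, of "(S ^^ k) (q i)"] by (simp add: norm_funpow_S)
    have vq: "inner ((S ^^ k) ((T ^^ k) ((T ^^ j) x))) (q i) = inner ((T ^^ j) x) (?v i)" for i j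
      by (simp only: adjoint_funpow[OF adj_S] adjoint_funpow[OF adj_T])
    have wq: "inner ((S ^^ k) (q i)) (S (T ((T ^^ j) x))) = inner ((T ^^ j) x) (?w i)" for i j
      by (subst inner_commute) (simp only: adj_S adj_T)
    have step: "transfer k ((T ^^ j) x) - transfer k ((T ^^ Suc j) x) =
        (\<Sum>i\<in>I. inner ((T ^^ (0 + j)) x) (p i) * inner ((T ^^ j) x) (?v i)) +
        (\<Sum>i\<in>I. inner ((T ^^ (k + j)) x) (p i) * inner ((T ^^ j) x) (?w i))" for j
      using transfer_step[of k "(T ^^ j) x"] unfolding vq wq by (simp add: funpow_add)
    have "transfer k ((T ^^ m) x) - transfer k ((T ^^ n) x) =
        (\<Sum>j\<in>{m..<n}. transfer k ((T ^^ j) x) - transfer k ((T ^^ Suc j) x))"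
      using sum_Suc_diff'[OF that, of "\<lambda>j. - transfer k ((T ^^ j) x)"] by simp
    also have "\<dots> =
        (\<Sum>j\<in>{m..<n}. \<Sum>i\<in>I. inner ((T ^^ (0 + j)) x) (p i) * inner ((T ^^ j) x) (?v i)) +
        (\<Sum>j\<in>{m..<n}. \<Sum>i\<in>I. inner ((T ^^ (k + j)) x) (p i) * inner ((T ^^ j) x) (?w i))"
      unfolding step sum.distrib ..
    finally have "transfer k ((T ^^ m) x) - transfer k ((T ^^ n) x) =
        (\<Sum>j\<in>{m..<n}. \<Sum>i\<in>I. inner ((T ^^ (0 + j)) x) (p i) * inner ((T ^^ j) x) (?v i)) +
        (\<Sum>j\<in>{m..<n}. \<Sum>i\<in>I. inner ((T ^^ (k + j)) x) (p i) * inner ((T ^^ j) x) (?w i))" .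
    with product[OF v, of m 0 n] product[OF w, of m k n] show ?thesis by linarith
  qed
  have bound: "\<delta> \<le> 2 * (\<eta> m * norm y * Q)" for m
  proof (rule LIMSEQ_le_const2)
    show "(\<lambda>k. \<delta> - transfer k ((T ^^ m) x)) \<longlonglongrightarrow> \<delta>"
      using tendsto_diff[OF tendsto_const transfer_tendsto_0] by simp
    have "\<delta> - transfer k ((T ^^ m) x) \<le> 2 * (\<eta> m * norm y * Q)" for k
    proof (rule LIMSEQ_le_const2)
      show "(\<lambda>n. transfer k ((T ^^ n) x) - transfer k ((T ^^ m) x))
          \<longlonglongrightarrow> \<delta> - transfer k ((T ^^ m) x)"
        using tendsto_add[OF transfer_along_orbit[of k x] lim] by (intro tendsto_diff) auto
    qed (use transfer_diff in blast)
    then show "\<exists>N. \<forall>k\<ge>N. \<delta> - transfer k ((T ^^ m) x) \<le> 2 * (\<eta> m * norm y * Q)" by blast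
  qed
  have "(\<lambda>m. 2 * (\<eta> m * norm y * Q)) \<longlonglongrightarrow> 2 * (sqrt (\<delta> - \<delta>) * norm y * Q)"
    unfolding \<eta>_def by (intro tendsto_intros lim)
  then have "\<delta> \<le> 0" using LIMSEQ_le_const[of _ _ \<delta>] bound by fastforce
  with \<open>\<delta> \<ge> 0\<close> lim have "(\<lambda>n. (norm ((T ^^ n) x))\<^sup>2) \<longlonglongrightarrow> 0" by simp
  then show ?thesis by (simp add: tendsto_norm_zero_iff)
qed

text \<open>The vectors whose orbits tend to \<open>0\<close> form a closed subspace \<open>Z\<close>, and \<open>z \<in> Z\<close> if and only if
  \<open>T z \<in> Z\<close>.  By the previous lemma \<open>Z\<close> contains the range of \<open>I - T T'\<close>, so \<open>T T'\<close> is the identity on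
  the orthogonal complement of \<open>Z\<close>.  On this complement \<open>T\<close> is then isometric, whence \<open>energy\<close> makes
  all coefficients in \<open>decomposition\<close> vanish.  A vector \<open>y\<close> of the complement is therefore equal to
  \<open>(S ^^ n) ((T ^^ n) y)\<close> for all \<open>n\<close>, and only \<open>0\<close> lies in the range of every \<open>S ^^ n\<close>.\<close>

theorem orbit_tendsto_0: "(\<lambda>n. (T ^^ n) x) \<longlonglongrightarrow> 0"
proof -
  define Z where "Z = {x. (\<lambda>n. (T ^^ n) x) \<longlonglongrightarrow> 0}"
  note lin = linear_funpow[OF lin_T]
  have Z: "subspace Z"
    unfolding subspace_def Z_def
    by (auto simp: linear_0[OF lin] linear_add[OF lin] linear_scale[OF lin]
        intro: tendsto_add_zero tendsto_scaleR[OF tendsto_const, where b = 0, simplified])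
  have "closed Z"
    unfolding closed_sequential_limits
  proof (intro allI impI, elim conjE)
    fix z l assume z: "\<forall>k. z k \<in> Z" "z \<longlonglongrightarrow> l"
    show "l \<in> Z"
      unfolding Z_def mem_Collect_eq LIMSEQ_iff
    proof (intro allI impI)
      fix r :: real assume r: "r > 0"
      obtain k where k: "norm (z k - l) < r / 2" using z(2) r by (metis LIMSEQ_iff half_gt_zero le_refl)
      have "(\<lambda>n. (T ^^ n) (z k)) \<longlonglongrightarrow> 0" using z(1) by (simp add: Z_def)
      then obtain N where N: "\<And>n. n \<ge> N \<Longrightarrow> norm ((T ^^ n) (z k)) < r / 2"
        using r by (metis LIMSEQ_iff half_gt_zero diff_zero)
      have "norm ((T ^^ n) l - 0) < r" if "n \<ge> N" for n
      proof -
        have "(T ^^ n) l = (T ^^ n) (z k) - (T ^^ n) (z k - l)" by (simp add: linear_diff[OF lin])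
        then have "norm ((T ^^ n) l) \<le> norm ((T ^^ n) (z k)) + norm (z k - l)"
          using norm_triangle_ineq4 norm_funpow_le[OF contraction, of n "z k - l"]
          by (smt (verit))
        with N[OF that] k show ?thesis by simp
      qed
      then show "\<exists>N. \<forall>n\<ge>N. norm ((T ^^ n) l - 0) < r" by blast
    qed
  qed
  have T_iff: "T z \<in> Z \<longleftrightarrow> z \<in> Z" for z
    using filterlim_sequentially_Suc[of "\<lambda>n. (T ^^ n) z" "nhds 0"]
    by (simp add: Z_def funpow_swap1)
  define Zp where "Zp = {v. \<forall>z\<in>Z. inner v z = 0}"
  have T'_Zp: "T' v \<in> Zp" if "v \<in> Zp" for v
    using that T_iff by (simp add: Zp_def inner_commute[of "T' v"] adj_T[symmetric]) (metis inner_commute)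
  have TT': "T (T' v) = v" if v: "v \<in> Zp" for v
  proof -
    define y where "y = v - T (T' v)"
    have "y - T (T' y) \<in> Z" using orbit_tendsto_0_on_defect_range[of _ y] by (simp add: Z_def)
    then have "inner v (y - T (T' y)) = 0" using v by (simp add: Zp_def)
    moreover have "inner v (y - T (T' y)) = inner y y"
      unfolding inner_diff_right
      by (subst (2) y_def) (simp add: inner_diff_left adj_T inner_commute[of v "T _"] inner_commute[of "T' y"])
    ultimately show ?thesis by (simp add: y_def)
  qed
  have T_Zp: "T y \<in> Zp \<and> norm (T y) = norm y" if y: "y \<in> Zp" for y
  proof -
    obtain z where z: "z \<in> Z" "\<And>w. w \<in> Z \<Longrightarrow> inner (T y - z) w = 0"
      using orthogonal_projection_exists[OF Z \<open>closed Z\<close>, of "T y"] by blast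
    define v where "v = T y - z"
    have v: "v \<in> Zp" using z by (simp add: Zp_def v_def)
    \<comment> \<open>\<open>T\<close> sends \<open>w\<close> into \<open>Z\<close>, so \<open>w\<close> lies both in \<open>Z\<close> and in its complement\<close>
    define w where "w = y - T' v"
    have "w \<in> Zp" using y T'_Zp[OF v] by (simp add: Zp_def w_def inner_diff)
    moreover have "T w = z" using TT'[OF v] by (simp add: w_def linear_diff[OF lin_T] v_def)
    then have "w \<in> Z" using z T_iff by metis
    ultimately have "inner w w = 0" unfolding Zp_def by blast
    then have y_eq: "y = T' v" by (simp add: w_def)
    then have Ty: "T y = v" using TT'[OF v] by simp
    have "norm v \<le> norm y" "norm y \<le> norm v"
      using contraction[of y] T'_contraction[of v] y_eq Ty by auto
    with Ty v show ?thesis by simp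
  qed
  have zero: "y = 0" if y: "y \<in> Zp" for y
  proof -
    have orbit: "(T ^^ n) y \<in> Zp \<and> y = (S ^^ n) ((T ^^ n) y)" for n
    proof (induction n)
      case (Suc n)
      define u where "u = (T ^^ n) y"
      have u: "u \<in> Zp" "y = (S ^^ n) u" using Suc by (auto simp: u_def)
      have "(\<Sum>i\<in>I. (inner u (p i))\<^sup>2) = 0"
        using energy[of u] T_Zp[OF u(1)] by simp
      then have "\<forall>i\<in>I. inner u (p i) = 0"
        by (subst (asm) sum_nonneg_eq_0_iff[OF finite_I]) auto
      then have "u = S (T u)" using decomposition[of u] by simp
      moreover have "(T ^^ Suc n) y = T u" by (simp add: u_def)
      moreover have "(S ^^ Suc n) (T u) = (S ^^ n) (S (T u))" by (simp add: funpow_swap1)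
      ultimately show ?case using u T_Zp[OF u(1)] by metis
    qed (use y in simp)
    have "transfer n y = inner y y" for n
      using orbit[of n] by (simp add: transfer_def)
    then have "inner y y = 0" using transfer_tendsto_0[of y] by (simp add: LIMSEQ_const_iff)
    then show ?thesis by simp
  qed
  obtain z where z: "z \<in> Z" "\<And>w. w \<in> Z \<Longrightarrow> inner (x - z) w = 0"
    using orthogonal_projection_exists[OF Z \<open>closed Z\<close>, of x] by blast
  then have "x = z" using zero[of "x - z"] by (simp add: Zp_def)
  with z show ?thesis by (simp add: Z_def)
qed

end

section \<open>Taylor coefficients\<close>

definition taylor :: "real_hardy \<Rightarrow> nat \<Rightarrow> real" where
  "taylor f n = Re (fps_nth (fps_of f) n)"

definition of_coeffs :: "(nat \<Rightarrow> real) \<Rightarrow> real_hardy" where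
  "of_coeffs a = Abs_real_hardy (Abs_fps (\<lambda>n. of_real (a n)))"

lemma fps_nth_fps_of: "fps_nth (fps_of f) n = of_real (taylor f n)"
  by (simp add: taylor_def)

lemma real_hardy_eqI: "(\<And>n. taylor f n = taylor g n) \<Longrightarrow> f = g"
  by (simp add: fps_of_inject[symmetric] fps_eq_iff fps_nth_fps_of)

lemma taylor_simps [simp]:
  "taylor 0 n = 0" "taylor (f + g) n = taylor f n + taylor g n"
  "taylor (f - g) n = taylor f n - taylor g n" "taylor (r *\<^sub>R f) n = r * taylor f n"
  by (simp_all add: taylor_def zero_real_hardy.rep_eq plus_real_hardy.rep_eq
      minus_real_hardy.rep_eq scaleR_real_hardy.rep_eq)

lemma taylor_mult_z [simp]: "taylor (mult_z f) n = (if n = 0 then 0 else taylor f (n - 1))"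
  by (simp add: taylor_def mult_z.rep_eq)

lemma taylor_backward_shift [simp]: "taylor (backward_shift f) n = taylor f (Suc n)"
  by (simp add: taylor_def backward_shift.rep_eq)

lemma taylor_of_coeffs:
  assumes "summable (\<lambda>n. (a n)\<^sup>2)"
  shows "taylor (of_coeffs a) n = a n"
proof -
  have "fps_of (of_coeffs a) = Abs_fps (\<lambda>n. of_real (a n))"
    unfolding of_coeffs_def by (rule Abs_real_hardy_inverse) (use assms in \<open>simp add: hardy_def\<close>)
  then show ?thesis by (simp add: taylor_def)
qed

lemma inner_sums: "(\<lambda>n. taylor f n * taylor g n) sums inner f g"
proof -
  have "(\<lambda>n. Re (fps_nth (fps_of f) n * cnj (fps_nth (fps_of g) n))) sums
      Re (hardy_inner (fps_of f) (fps_of g))"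
    unfolding hardy_inner_def
    by (intro sums_Re summable_sums hardy_inner_summable fps_of_hardy)
  then show ?thesis by (simp add: inner_real_hardy_def fps_nth_fps_of)
qed

lemma norm_sums: "(\<lambda>n. (taylor f n)\<^sup>2) sums (norm f)\<^sup>2"
  using inner_sums[of f f] unfolding power2_norm_eq_inner by (simp add: power2_eq_square)

lemma partial_sum_le_norm: "(\<Sum>n<k. (taylor f n)\<^sup>2) \<le> (norm f)\<^sup>2"
  using norm_sums[of f] by (metis sum_le_suminf sums_iff finite_lessThan zero_le_power2)

lemma abs_taylor_le_norm: "\<bar>taylor f n\<bar> \<le> norm f"
proof -
  have "(taylor f n)\<^sup>2 \<le> (\<Sum>i<Suc n. (taylor f i)\<^sup>2)" by (simp add: sum_nonneg)
  also have "\<dots> \<le> (norm f)\<^sup>2" by (rule partial_sum_le_norm)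
  finally show ?thesis by (simp add: abs_le_square_iff[symmetric])
qed

lemma norm_le_of_partial_sums:
  assumes "\<And>k. (\<Sum>n<k. (taylor f n)\<^sup>2) \<le> c"
  shows "(norm f)\<^sup>2 \<le> c"
  using norm_sums[of f] suminf_le_const[of "\<lambda>n. (taylor f n)\<^sup>2" c] assms by (simp add: sums_iff)

text \<open>The usual proof for \<open>\<ell>\<^sup>2\<close>: coefficientwise limits, with the norm controlled by partial sums so that
  limits can be taken under finitely many terms.\<close>

instance real_hardy :: complete_space
proof
  fix X :: "nat \<Rightarrow> real_hardy"
  assume X: "Cauchy X"
  have "Cauchy (\<lambda>k. taylor (X k) n)" for n
  proof (rule metric_CauchyI)
    fix r :: real assume "r > 0"
    then obtain K where "\<And>j k. j \<ge> K \<Longrightarrow> k \<ge> K \<Longrightarrow> dist (X j) (X k) < r"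
      using metric_CauchyD[OF X] by blast
    moreover have "dist (taylor (X j) n) (taylor (X k) n) \<le> dist (X j) (X k)" for j k
      using abs_taylor_le_norm[of "X j - X k" n] by (simp add: dist_norm)
    ultimately show "\<exists>K. \<forall>j\<ge>K. \<forall>k\<ge>K. dist (taylor (X j) n) (taylor (X k) n) < r"
      by (meson le_less_trans)
  qed
  then have "\<forall>n. \<exists>l. (\<lambda>k. taylor (X k) n) \<longlonglongrightarrow> l"
    by (simp add: Cauchy_convergent_iff convergent_def)
  then obtain a where a: "\<And>n. (\<lambda>k. taylor (X k) n) \<longlonglongrightarrow> a n" by metis
  obtain C where C: "\<And>k. norm (X k) \<le> C"
    using Cauchy_Bseq[OF X] by (auto simp: Bseq_def)
  have summable: "summable (\<lambda>n. (a n)\<^sup>2)"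
  proof (rule summableI_nonneg_bounded)
    fix m
    show "(\<Sum>n<m. (a n)\<^sup>2) \<le> C\<^sup>2"
    proof (rule LIMSEQ_le_const2)
      show "(\<lambda>k. \<Sum>n<m. (taylor (X k) n)\<^sup>2) \<longlonglongrightarrow> (\<Sum>n<m. (a n)\<^sup>2)"
        by (intro tendsto_intros a)
      have "(\<Sum>n<m. (taylor (X k) n)\<^sup>2) \<le> C\<^sup>2" for k
        using partial_sum_le_norm[of "X k" m] power_mono[OF C[of k] norm_ge_zero, of 2] by linarith
      then show "\<exists>K. \<forall>k\<ge>K. (\<Sum>n<m. (taylor (X k) n)\<^sup>2) \<le> C\<^sup>2" by blast
    qed
  qed simp
  have "X \<longlonglongrightarrow> of_coeffs a"
  proof (rule metric_LIMSEQ_I)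
    fix r :: real assume "r > 0"
    then obtain K where K: "\<And>j k. j \<ge> K \<Longrightarrow> k \<ge> K \<Longrightarrow> dist (X j) (X k) < r / 2"
      using metric_CauchyD[OF X, of "r / 2"] by auto
    have "dist (X k) (of_coeffs a) < r" if k: "k \<ge> K" for k
    proof -
      have "(norm (X k - of_coeffs a))\<^sup>2 \<le> (r / 2)\<^sup>2"
      proof (rule norm_le_of_partial_sums, rule LIMSEQ_le_const2)
        fix m
        show "(\<lambda>j. \<Sum>n<m. (taylor (X k - X j) n)\<^sup>2) \<longlonglongrightarrow> (\<Sum>n<m. (taylor (X k - of_coeffs a) n)\<^sup>2)"
          by (simp add: taylor_of_coeffs[OF summable]) (intro tendsto_intros a)
        have "(\<Sum>n<m. (taylor (X k - X j) n)\<^sup>2) \<le> (r / 2)\<^sup>2" if "j \<ge> K" for j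
        proof -
          have "(\<Sum>n<m. (taylor (X k - X j) n)\<^sup>2) \<le> (norm (X k - X j))\<^sup>2" by (rule partial_sum_le_norm)
          also have "\<dots> \<le> (r / 2)\<^sup>2" using K[OF k that] by (intro power_mono) (auto simp: dist_norm)
          finally show ?thesis .
        qed
        then show "\<exists>J. \<forall>j\<ge>J. (\<Sum>n<m. (taylor (X k - X j) n)\<^sup>2) \<le> (r / 2)\<^sup>2" by blast
      qed
      then have "norm (X k - of_coeffs a) \<le> r / 2" using \<open>r > 0\<close> by (simp add: power2_le_iff_abs_le)
      then show ?thesis using \<open>r > 0\<close> by (simp add: dist_norm)
    qed
    then show "\<exists>K. \<forall>k\<ge>K. dist (X k) (of_coeffs a) < r" by blast
  qed
  then show "convergent X" by (auto simp: convergent_def)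
qed

section \<open>The shift and its adjoint\<close>

lemma linear_mult_z: "linear mult_z"
  by (rule linearI) (auto intro!: real_hardy_eqI)

lemma linear_backward_shift: "linear backward_shift"
  by (rule linearI) (auto intro!: real_hardy_eqI)

lemma backward_shift_mult_z [simp]: "backward_shift (mult_z f) = f"
  by (rule real_hardy_eqI) simp

lemma inner_mult_z: "inner (mult_z f) g = inner f (backward_shift g)"
proof -
  have "(\<lambda>n. taylor (mult_z f) (Suc n) * taylor g (Suc n)) sums (inner (mult_z f) g)"
    using inner_sums[of "mult_z f" g] sums_Suc_iff[of "\<lambda>n. taylor (mult_z f) n * taylor g n"] by simp
  moreover have "(\<lambda>n. taylor (mult_z f) (Suc n) * taylor g (Suc n)) sums inner f (backward_shift g)"
    using inner_sums[of f "backward_shift g"] by simp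
  ultimately show ?thesis by (rule sums_unique2)
qed

lemma norm_mult_z [simp]: "norm (mult_z f) = norm f"
  by (simp add: norm_eq_sqrt_inner inner_mult_z)

lemma taylor_funpow_backward_shift: "taylor ((backward_shift ^^ k) f) n = taylor f (n + k)"
  by (induction k arbitrary: n) simp_all

text \<open>The squared norm of \<open>(backward_shift ^^ k) f\<close> is the tail of the series for \<open>(norm f)\<^sup>2\<close>.\<close>

lemma backward_shift_stable: "(\<lambda>k. (backward_shift ^^ k) f) \<longlonglongrightarrow> 0"
proof -
  let ?a = "\<lambda>n. (taylor f n)\<^sup>2"
  have a: "summable ?a" "suminf ?a = (norm f)\<^sup>2" using norm_sums[of f] by (auto simp: sums_iff)
  have "(norm ((backward_shift ^^ k) f))\<^sup>2 = (norm f)\<^sup>2 - sum ?a {..<k}" for k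
  proof -
    have "(norm ((backward_shift ^^ k) f))\<^sup>2 = (\<Sum>n. ?a (n + k))"
      using norm_sums[of "(backward_shift ^^ k) f"] by (simp add: sums_iff taylor_funpow_backward_shift)
    then show ?thesis using suminf_minus_initial_segment[OF a(1), of k] a(2) by simp
  qed
  moreover have "(\<lambda>k. (norm f)\<^sup>2 - sum ?a {..<k}) \<longlonglongrightarrow> (norm f)\<^sup>2 - (norm f)\<^sup>2"
    using summable_LIMSEQ[OF a(1)] a(2) by (intro tendsto_intros) simp
  ultimately have "(\<lambda>k. (norm ((backward_shift ^^ k) f))\<^sup>2) \<longlonglongrightarrow> 0" by simp
  then show ?thesis by (simp add: tendsto_norm_zero_iff)
qed

definition const_one :: real_hardy where
  "const_one = of_coeffs (\<lambda>n. if n = 0 then 1 else 0)"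

lemma taylor_const_one [simp]: "taylor const_one n = (if n = 0 then 1 else 0)"
  unfolding const_one_def
  by (rule taylor_of_coeffs) (rule summable_finite[of "{0}"], auto)

lemma inner_const_one: "inner f const_one = taylor f 0"
proof -
  have "(\<lambda>n. taylor f n * taylor const_one n) sums (\<Sum>n\<in>{0}. taylor f n * taylor const_one n)"
    by (rule sums_finite) auto
  then show ?thesis using inner_sums[of f const_one] by (simp add: sums_unique2)
qed

lemma constant_plus_shift: "f = taylor f 0 *\<^sub>R const_one + mult_z (backward_shift f)"
  by (rule real_hardy_eqI) simp

lemma norm_constant_plus_shift: "(norm f)\<^sup>2 = (taylor f 0)\<^sup>2 + (norm (backward_shift f))\<^sup>2"
  using norm_sums[of f] norm_sums[of "backward_shift f"] sums_Suc_iff[of "\<lambda>n. (taylor f n)\<^sup>2"]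
  by (auto dest: sums_unique2)

lemma range_mult_z_iff: "f \<in> range mult_z \<longleftrightarrow> taylor f 0 = 0"
proof
  assume "taylor f 0 = 0"
  then have "f = mult_z (backward_shift f)" using constant_plus_shift[of f] by simp
  then show "f \<in> range mult_z" by blast
qed auto

section \<open>Functions on the disc\<close>

lemma fun_of_0: "fun_of f 0 = of_real (taylor f 0)"
  by (simp add: fun_of_def eval_fps_at_0 fps_nth_fps_of)

lemma fun_of_inject: "fun_of f = fun_of g \<longleftrightarrow> f = g"
proof
  assume eq: "fun_of f = fun_of g"
  have "eval_fps (fps_of f) z = eval_fps (fps_of g) z" if "z \<in> unit_disc" for z
    using fun_cong[OF eq, of z] that by (simp add: fun_of_def)
  then have "eventually (\<lambda>z. eval_fps (fps_of f) z = eval_fps (fps_of g) z) (nhds 0)"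
    by (intro eventually_nhds[THEN iffD2] exI[of _ unit_disc]) auto
  moreover have "fps_conv_radius (fps_of h) > 0" for h
    using fun_of_conv_radius[of 0 h] by (simp add: zero_ereal_def)
  ultimately have "fps_of f = fps_of g" by (intro eval_fps_eqD)
  then show "f = g" by (simp add: fps_of_inject)
qed simp

lemma fun_of_eqI:
  assumes "fps_of f = fps_of g * fps_of h + fps_X * fps_of h1 * fps_of e"
  shows "fun_of f = (\<lambda>z\<in>unit_disc. fun_of g z * fun_of h z + z * fun_of h1 z * fun_of e z)"
proof (rule ext)
  fix z :: complex
  show "fun_of f z = (\<lambda>z\<in>unit_disc. fun_of g z * fun_of h z + z * fun_of h1 z * fun_of e z) z"
  proof (cases "z \<in> unit_disc")
    case True
    note r = fun_of_conv_radius[OF True]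
    have prod: "norm z < fps_conv_radius (u * v)"
      if "norm z < fps_conv_radius u" "norm z < fps_conv_radius v" for u v :: "complex fps"
      using less_le_trans[OF _ fps_conv_radius_mult[of u v]] that by simp
    have "norm z < fps_conv_radius (fps_X :: complex fps)" by simp
    then show ?thesis
      using True r by (simp add: fun_of_def assms eval_fps_add eval_fps_mult prod)
  qed (simp add: fun_of_def)
qed

section \<open>Expansion along the extremal function and the defect vector\<close>

text \<open>The two cases of the theorem are treated together: \<open>g\<close> is the extremal function of \<open>M\<close> in the
  first case and \<open>0\<close> in the second.\<close>

locale defect_one_frame =
  fixes M :: "real_hardy set" and g e :: real_hardy
  assumes M: "subspace M" "closed M"
    and e_unit: "norm e = 1" and e_ortho: "\<And>f. f \<in> M \<Longrightarrow> inner f e = 0"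
    and g: "g \<in> M" "norm g = 1 \<or> g = 0"
    and vanishing_remainder: "\<And>f. f \<in> M \<Longrightarrow> taylor (f - inner f g *\<^sub>R g) 0 = 0"
    and almost_invariant:
      "\<And>f. f \<in> M \<Longrightarrow> taylor f 0 = 0 \<Longrightarrow> \<exists>m\<in>M. \<exists>c. backward_shift f = m + c *\<^sub>R e"
begin

definition remainder :: "real_hardy \<Rightarrow> real_hardy" where
  "remainder f = f - inner f g *\<^sub>R g"

definition b :: "real_hardy \<Rightarrow> real" where
  "b f = inner (backward_shift (remainder f)) e"

text \<open>On \<open>M\<close> the operator \<open>T\<close> removes the \<open>g\<close>-component, divides by \<open>z\<close> and projects back to \<open>M\<close>.  It is
  defined on the whole space because its adjoint \<open>T'\<close> then has an explicit formula, which the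
  projection onto \<open>M\<close> would not allow.  The price is one further perturbation term, with values
  in the constants, since outside \<open>M\<close> the remainder need not vanish at \<open>0\<close>.\<close>

definition T :: "real_hardy \<Rightarrow> real_hardy" where
  "T f = backward_shift (remainder f) - b f *\<^sub>R e"

definition T' :: "real_hardy \<Rightarrow> real_hardy" where
  "T' f = remainder (mult_z (f - inner f e *\<^sub>R e))"

text \<open>The vectors \<open>p i\<close> represent the three coefficients in the expansion of \<open>f\<close> as a sum of \<open>z (T f)\<close> and
  multiples of \<open>q 0\<close>, \<open>q 1\<close> and \<open>q 2\<close>: the product with \<open>g\<close>, the value of the remainder at \<open>0\<close>, and \<open>b f\<close>.\<close>

definition p :: "nat \<Rightarrow> real_hardy" where
  "p i = [g, const_one - taylor g 0 *\<^sub>R g, remainder (mult_z e)] ! i"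

definition q :: "nat \<Rightarrow> real_hardy" where
  "q i = [g, const_one, mult_z e] ! i"

lemma linear_remainder: "linear remainder"
  by (rule linearI) (simp_all add: remainder_def inner_add_left algebra_simps)

lemma inner_remainder: "inner (remainder f) h = inner f (remainder h)"
  by (simp add: remainder_def inner_diff inner_commute)

lemma norm_remainder: "(norm f)\<^sup>2 = (inner f g)\<^sup>2 + (norm (remainder f))\<^sup>2"
proof -
  have "inner f g * inner g g * inner f g = inner f g * inner f g"
    using g(2) by (auto simp: norm_eq_1)
  then show ?thesis
    unfolding power2_norm_eq_inner
    by (simp add: remainder_def inner_diff inner_commute[of g f] power2_eq_square algebra_simps)
qed

lemma linear_b: "linear b"
  by (rule linearI)
     (simp_all add: b_def linear_add[OF linear_remainder] linear_add[OF linear_backward_shift]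
       linear_scale[OF linear_remainder] linear_scale[OF linear_backward_shift] inner_add_left)

lemma linear_T: "linear T"
  by (rule linearI)
     (simp_all add: T_def linear_add[OF linear_remainder] linear_add[OF linear_backward_shift]
       linear_scale[OF linear_remainder] linear_scale[OF linear_backward_shift]
       linear_add[OF linear_b] linear_scale[OF linear_b] algebra_simps)

lemma inner_p: "inner f (p 0) = inner f g" "inner f (p 1) = taylor (remainder f) 0" "inner f (p 2) = b f"
proof -
  show "inner f (p 0) = inner f g" by (simp add: p_def)
  show "inner f (p 1) = taylor (remainder f) 0"
    by (simp add: p_def inner_diff_right inner_const_one remainder_def)
  show "inner f (p 2) = b f"
    by (simp add: p_def b_def flip: inner_remainder)
       (metis inner_commute inner_mult_z)
qed

lemma T_decomposition:
  "f = inner f g *\<^sub>R g + taylor (remainder f) 0 *\<^sub>R const_one + b f *\<^sub>R mult_z e + mult_z (T f)"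
proof -
  have f: "f = inner f g *\<^sub>R g + remainder f" by (simp add: remainder_def)
  have remainder: "remainder f = taylor (remainder f) 0 *\<^sub>R const_one + mult_z (T f + b f *\<^sub>R e)"
    by (subst constant_plus_shift) (simp add: T_def)
  show ?thesis
    by (subst (1) f, subst (1) remainder)
       (simp only: linear_add[OF linear_mult_z] linear_scale[OF linear_mult_z] add_ac)
qed

lemma T_energy:
  "(norm f)\<^sup>2 = (inner f g)\<^sup>2 + (taylor (remainder f) 0)\<^sup>2 + (b f)\<^sup>2 + (norm (T f))\<^sup>2"
proof -
  have "inner e e = 1" using e_unit by (simp add: norm_eq_1)
  then have "(norm (u - inner u e *\<^sub>R e))\<^sup>2 = (norm u)\<^sup>2 - (inner u e)\<^sup>2" for u
    unfolding power2_norm_eq_inner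
    by (simp add: inner_diff inner_commute[of e u] power2_eq_square)
  then have "(norm (T f))\<^sup>2 = (norm (backward_shift (remainder f)))\<^sup>2 - (b f)\<^sup>2"
    unfolding T_def b_def .
  then show ?thesis
    using norm_remainder[of f] norm_constant_plus_shift[of "remainder f"] by simp
qed

sublocale perturbed_backward_shift mult_z backward_shift T T' "{0,1,2::nat}" p q
proof
  fix f h
  have "inner (T f) h = inner (backward_shift (remainder f)) (h - inner h e *\<^sub>R e)"
    by (simp add: T_def b_def inner_diff inner_commute[of e h])
  also have "\<dots> = inner (remainder f) (mult_z (h - inner h e *\<^sub>R e))"
    by (subst inner_commute, subst inner_mult_z[symmetric], rule inner_commute)
  finally show "inner (T f) h = inner f (T' h)" by (simp only: inner_remainder T'_def)
  show "f = mult_z (T f) + (\<Sum>i\<in>{0,1,2}. inner f (p i) *\<^sub>R q i)"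
    using T_decomposition[of f] by (simp add: inner_p inner_p(2)[simplified] q_def add_ac)
  show "(norm f)\<^sup>2 = (norm (T f))\<^sup>2 + (\<Sum>i\<in>{0,1,2}. (inner f (p i))\<^sup>2)"
    using T_energy[of f] by (simp add: inner_p inner_p(2)[simplified])
qed (rule linear_add[OF linear_mult_z] linear_scale[OF linear_mult_z] linear_add[OF linear_T]
      linear_scale[OF linear_T] inner_mult_z backward_shift_stable norm_mult_z finite.intros)+

text \<open>As \<open>e\<close> is a unit vector orthogonal to \<open>M\<close>, the coefficient of \<open>e\<close> in the backward shift of the
  remainder is \<open>b f\<close>, and subtracting \<open>b f *\<^sub>R e\<close> leaves the component in \<open>M\<close>.\<close>

lemma T_in_M:
  assumes "f \<in> M"
  shows "T f \<in> M"
proof -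
  have "remainder f \<in> M"
    using assms g M by (simp add: remainder_def subspace_diff subspace_scale)
  moreover have "taylor (remainder f) 0 = 0" using vanishing_remainder[OF assms] by (simp add: remainder_def)
  ultimately obtain m c where m: "m \<in> M" "backward_shift (remainder f) = m + c *\<^sub>R e"
    using almost_invariant by blast
  have "b f = c" using m e_ortho[of m] e_unit by (simp add: b_def inner_add_left norm_eq_1)
  then show ?thesis using m by (simp add: T_def)
qed

lemma T_funpow_in_M: "f \<in> M \<Longrightarrow> (T ^^ n) f \<in> M"
  by (induction n) (auto intro: T_in_M)

text \<open>Substituting \<open>T_decomposition\<close> into itself collects the factors \<open>H f\<close> of \<open>g\<close> and \<open>H1 f\<close> of \<open>z e\<close>.\<close>

definition H :: "real_hardy \<Rightarrow> real_hardy" where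
  "H f = of_coeffs (\<lambda>n. inner ((T ^^ n) f) g)"

definition H1 :: "real_hardy \<Rightarrow> real_hardy" where
  "H1 f = of_coeffs (\<lambda>n. b ((T ^^ n) f))"

lemma partial_energy:
  "(\<Sum>k<n. (inner ((T ^^ k) f) g)\<^sup>2) + (\<Sum>k<n. (b ((T ^^ k) f))\<^sup>2) +
     (\<Sum>k<n. (taylor (remainder ((T ^^ k) f)) 0)\<^sup>2) = (norm f)\<^sup>2 - (norm ((T ^^ n) f))\<^sup>2"
proof (induction n)
  case (Suc n)
  then show ?case using T_energy[of "(T ^^ n) f"] by simp
qed simp

lemma partial_energy_le:
  "(\<Sum>k<n. (inner ((T ^^ k) f) g)\<^sup>2) \<le> (norm f)\<^sup>2" (is ?A)
  "(\<Sum>k<n. (b ((T ^^ k) f))\<^sup>2) \<le> (norm f)\<^sup>2" (is ?B)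
proof -
  have nonneg: "(\<Sum>k<n. (a k)\<^sup>2) \<ge> 0" for a :: "nat \<Rightarrow> real" by (simp add: sum_nonneg)
  note facts = partial_energy[where n = n and f = f] zero_le_power2[of "norm ((T ^^ n) f)"]
    nonneg[of "\<lambda>k. inner ((T ^^ k) f) g"] nonneg[of "\<lambda>k. b ((T ^^ k) f)"]
    nonneg[of "\<lambda>k. taylor (remainder ((T ^^ k) f)) 0"]
  show ?A using facts by linarith
  show ?B using facts by linarith
qed

lemma summable_coefficients:
  "summable (\<lambda>n. (inner ((T ^^ n) f) g)\<^sup>2)" "summable (\<lambda>n. (b ((T ^^ n) f))\<^sup>2)"
  by (rule summableI_nonneg_bounded, simp, rule partial_energy_le)+

lemma taylor_H: "taylor (H f) n = inner ((T ^^ n) f) g"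
  unfolding H_def by (rule taylor_of_coeffs[OF summable_coefficients(1)])

lemma taylor_H1: "taylor (H1 f) n = b ((T ^^ n) f)"
  unfolding H1_def by (rule taylor_of_coeffs[OF summable_coefficients(2)])

lemma backward_shift_H: "backward_shift (H f) = H (T f)"
  by (rule real_hardy_eqI) (simp add: taylor_H funpow_swap1)

lemma backward_shift_H1: "backward_shift (H1 f) = H1 (T f)"
  by (rule real_hardy_eqI) (simp add: taylor_H1 funpow_swap1)

lemma linear_H: "linear H"
  by (rule linearI; rule real_hardy_eqI)
     (simp_all add: taylor_H linear_add[OF linear_funpow[OF linear_T]]
       linear_scale[OF linear_funpow[OF linear_T]] inner_add_left)

lemma linear_H1: "linear H1"
  by (rule linearI; rule real_hardy_eqI)
     (simp_all add: taylor_H1 linear_add[OF linear_funpow[OF linear_T]]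
       linear_scale[OF linear_funpow[OF linear_T]] linear_add[OF linear_b] linear_scale[OF linear_b])

text \<open>The partial sums of the two norms fall short of \<open>(norm f)\<^sup>2\<close> by \<open>(norm ((T ^^ n) f))\<^sup>2\<close>; this is where
  the convergence of the iterates of \<open>T\<close> to \<open>0\<close> is needed.\<close>

lemma norm_H_H1:
  assumes "f \<in> M"
  shows "(norm f)\<^sup>2 = (norm (H f))\<^sup>2 + (norm (H1 f))\<^sup>2"
proof -
  have zero: "taylor (remainder ((T ^^ k) f)) 0 = 0" for k
    using vanishing_remainder[OF T_funpow_in_M[OF assms]] by (simp add: remainder_def)
  have "(\<lambda>n. (\<Sum>k<n. (inner ((T ^^ k) f) g)\<^sup>2) + (\<Sum>k<n. (b ((T ^^ k) f))\<^sup>2))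
      \<longlonglongrightarrow> (norm (H f))\<^sup>2 + (norm (H1 f))\<^sup>2"
    using norm_sums[of "H f"] norm_sums[of "H1 f"] unfolding taylor_H taylor_H1 sums_def
    by (intro tendsto_add)
  moreover have "(\<lambda>n. (norm f)\<^sup>2 - (norm ((T ^^ n) f))\<^sup>2) \<longlonglongrightarrow> (norm f)\<^sup>2 - (norm (0 :: real_hardy))\<^sup>2"
    by (intro tendsto_intros orbit_tendsto_0)
  ultimately show ?thesis
    using LIMSEQ_unique partial_energy[where f = f] by (simp add: zero)
qed

lemma norm_H_H1_le: "norm (H f) \<le> norm f" "norm (H1 f) \<le> norm f"
proof -
  have "(norm (H f))\<^sup>2 \<le> (norm f)\<^sup>2" "(norm (H1 f))\<^sup>2 \<le> (norm f)\<^sup>2"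
    by (rule norm_le_of_partial_sums, simp only: taylor_H taylor_H1, rule partial_energy_le)+
  then show "norm (H f) \<le> norm f" "norm (H1 f) \<le> norm f" by simp_all
qed

text \<open>The difference \<open>D f\<close> of the two sides satisfies \<open>D f = z * D (T f)\<close> on \<open>M\<close>, so all its coefficients
  vanish.\<close>

lemma factorization:
  assumes "f \<in> M"
  shows "fps_of f = fps_of g * fps_of (H f) + fps_X * fps_of (H1 f) * fps_of e"
proof -
  define D where "D f = fps_of g * fps_of (H f) + fps_X * fps_of (H1 f) * fps_of e - fps_of f" for f
  have expand: "fps_of h = fps_const (of_real (taylor h 0)) + fps_X * fps_of (backward_shift h)" for h
    by (subst constant_plus_shift)
       (simp add: plus_real_hardy.rep_eq scaleR_real_hardy.rep_eq mult_z.rep_eq fps_eq_iff fps_nth_fps_of)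
  have step: "D f = fps_X * D (T f)" if "f \<in> M" for f
  proof -
    have "f = inner f g *\<^sub>R g + b f *\<^sub>R mult_z e + mult_z (T f)"
      using T_decomposition[of f] vanishing_remainder[OF that] by (simp add: remainder_def)
    then have f: "fps_of f = fps_const (of_real (inner f g)) * fps_of g +
        fps_const (of_real (b f)) * (fps_X * fps_of e) + fps_X * fps_of (T f)"
      by (metis plus_real_hardy.rep_eq scaleR_real_hardy.rep_eq mult_z.rep_eq)
    show ?thesis
      unfolding D_def f expand[of "H f"] expand[of "H1 f"] backward_shift_H backward_shift_H1
      by (simp add: taylor_H taylor_H1 algebra_simps)
  qed
  have "fps_nth (D f) n = 0" if "f \<in> M" for n f
    using that
  proof (induction n arbitrary: f)
    case (Suc n)
    then show ?case by (simp add: step[OF Suc.prems] T_in_M)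
  qed (simp add: step)
  then have "D f = 0" using assms by (simp add: fps_eq_iff)
  then show ?thesis by (simp add: D_def)
qed

lemma fun_of_factorization:
  "f \<in> M \<Longrightarrow> fun_of f =
     (\<lambda>z\<in>unit_disc. fun_of g z * fun_of (H f) z + z * fun_of (H1 f) z * fun_of e z)"
  by (rule fun_of_eqI[OF factorization])

definition pair_model :: "(real_hardy \<times> real_hardy) set" where
  "pair_model = (\<lambda>f. (H f, H1 f)) ` M"

text \<open>\<open>H\<close> and \<open>H1\<close> turn \<open>T\<close> into the backward shift, and together they map \<open>M\<close> isometrically, so the
  image is complete.\<close>

lemma bounded_linear_H: "bounded_linear H"
  using linear_H norm_H_H1_le(1) by (intro bounded_linear_intro[where K = 1]) (auto simp: linear_add linear_scale)

lemma bounded_linear_H1: "bounded_linear H1"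
  using linear_H1 norm_H_H1_le(2) by (intro bounded_linear_intro[where K = 1]) (auto simp: linear_add linear_scale)

lemma subspace_pair_model: "subspace pair_model"
  unfolding pair_model_def
  by (intro linear_subspace_image M bounded_linear.linear bounded_linear_Pair bounded_linear_H bounded_linear_H1)

lemma closed_pair_model: "closed pair_model"
  unfolding pair_model_def
proof (intro complete_imp_closed complete_isometric_image[where e = 1])
  show "bounded_linear (\<lambda>f. (H f, H1 f))"
    by (intro bounded_linear_Pair bounded_linear_H bounded_linear_H1)
  show "\<forall>f\<in>M. 1 * norm f \<le> norm (H f, H1 f)"
    by (simp add: norm_Pair norm_H_H1[symmetric])
  show "complete M" using M by (simp add: complete_eq_closed)
qed (use M in auto)

lemma pair_model_invariant: "map_prod backward_shift backward_shift ` pair_model \<subseteq> pair_model"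
  by (auto simp: pair_model_def backward_shift_H backward_shift_H1 T_in_M)

lemma fun_of_image_M:
  "fun_of ` M =
     {(\<lambda>z\<in>unit_disc. fun_of g z * fun_of h z + z * fun_of h1 z * fun_of e z) | h h1. (h, h1) \<in> pair_model}"
  unfolding pair_model_def using fun_of_factorization by (auto simp: image_iff)

lemma pair_model_norm:
  assumes "(h, h1) \<in> pair_model"
    "fun_of f = (\<lambda>z\<in>unit_disc. fun_of g z * fun_of h z + z * fun_of h1 z * fun_of e z)"
  shows "(norm f)\<^sup>2 = (norm h)\<^sup>2 + (norm h1)\<^sup>2"
proof -
  obtain f' where f': "f' \<in> M" "h = H f'" "h1 = H1 f'" using assms(1) by (auto simp: pair_model_def)
  then have "f = f'" using assms(2) fun_of_factorization[OF f'(1)] by (simp add: fun_of_inject[symmetric])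
  then show ?thesis using f' norm_H_H1 by simp
qed

definition single_model :: "real_hardy set" where
  "single_model = H1 ` M"

context
  assumes g_eq_0: "g = 0"
begin

lemma H_eq_0: "H f = 0"
  by (rule real_hardy_eqI) (simp only: taylor_H taylor_simps, simp only: g_eq_0 inner_zero_right)

lemma norm_H1: "f \<in> M \<Longrightarrow> norm (H1 f) = norm f"
  using norm_H_H1[of f] by (simp add: H_eq_0)

lemma subspace_single_model: "subspace single_model"
  unfolding single_model_def by (intro linear_subspace_image M linear_H1)

lemma closed_single_model: "closed single_model"
  unfolding single_model_def
proof (intro complete_imp_closed complete_isometric_image[where e = 1])
  show "complete M" using M by (simp add: complete_eq_closed)
qed (use M norm_H1 bounded_linear_H1 in auto)

lemma single_model_invariant: "backward_shift ` single_model \<subseteq> single_model"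
  by (auto simp: single_model_def backward_shift_H1 T_in_M)

lemma fun_of_factorization1:
  "f \<in> M \<Longrightarrow> fun_of f = (\<lambda>z\<in>unit_disc. z * fun_of (H1 f) z * fun_of e z)"
  using fun_of_factorization[of f]
  by (simp add: g_eq_0 fun_of_def[of 0] zero_real_hardy.rep_eq cong: restrict_cong)

lemma fun_of_image_M1:
  "fun_of ` M = {(\<lambda>z\<in>unit_disc. z * fun_of h1 z * fun_of e z) | h1. h1 \<in> single_model}"
  unfolding single_model_def using fun_of_factorization1 by (auto simp: image_iff)

lemma single_model_norm:
  assumes "h1 \<in> single_model" "fun_of f = (\<lambda>z\<in>unit_disc. z * fun_of h1 z * fun_of e z)"
  shows "norm f = norm h1"
proof -
  obtain f' where f': "f' \<in> M" "h1 = H1 f'" using assms(1) by (auto simp: single_model_def)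
  then have "f = f'" using assms(2) fun_of_factorization1[OF f'(1)] by (simp add: fun_of_inject[symmetric])
  then show ?thesis using f' norm_H1 by simp
qed

end

end

section \<open>The extremal function and the representation of \<open>M\<close>\<close>

text \<open>The projection \<open>k\<close> of the constant \<open>1\<close> onto \<open>M\<close> represents evaluation at \<open>0\<close> on \<open>M\<close>.  It is therefore
  orthogonal to the functions in \<open>M\<close> that vanish at \<open>0\<close>, and it spans the orthogonal complement of
  these in \<open>M\<close>, so the sign and the norm determine the multiple.\<close>

lemma extremal_function:
  assumes M: "subspace M" "closed M" and f0: "f0 \<in> M" "taylor f0 0 \<noteq> 0"
  shows "\<exists>!g. g \<in> M \<and> norm g = 1 \<and> (\<forall>f \<in> M \<inter> range mult_z. orthogonal g f) \<and>
      fun_of g 0 \<in> \<real> \<and> Re (fun_of g 0) > 0"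
proof -
  obtain k where k: "k \<in> M" "\<And>f. f \<in> M \<Longrightarrow> inner (const_one - k) f = 0"
    using orthogonal_projection_exists[OF M, of const_one] by blast
  have eval: "inner k f = taylor f 0" if "f \<in> M" for f
    using k(2)[OF that] inner_const_one[of f] by (simp add: inner_diff inner_commute)
  have "k \<noteq> 0" using eval[OF f0(1)] f0(2) by auto
  have k0: "taylor k 0 > 0" using eval[OF k(1)] \<open>k \<noteq> 0\<close> by (metis inner_gt_zero_iff)
  show ?thesis
  proof (rule ex1I)
    show "k /\<^sub>R norm k \<in> M \<and> norm (k /\<^sub>R norm k) = 1 \<and>
      (\<forall>f \<in> M \<inter> range mult_z. orthogonal (k /\<^sub>R norm k) f) \<and>
      fun_of (k /\<^sub>R norm k) 0 \<in> \<real> \<and> Re (fun_of (k /\<^sub>R norm k) 0) > 0"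
      using \<open>k \<noteq> 0\<close> k(1) M k0
      by (auto simp: subspace_scale orthogonal_def eval range_mult_z_iff fun_of_0)
  next
    fix g assume g: "g \<in> M \<and> norm g = 1 \<and> (\<forall>f \<in> M \<inter> range mult_z. orthogonal g f) \<and>
      fun_of g 0 \<in> \<real> \<and> Re (fun_of g 0) > 0"
    \<comment> \<open>with this factor \<open>g - t *\<^sub>R k\<close> vanishes at \<open>0\<close> and is orthogonal to both \<open>g\<close> and \<open>k\<close>\<close>
    define t where "t = taylor g 0 / taylor k 0"
    define m where "m = g - t *\<^sub>R k"
    have m: "m \<in> M" "taylor m 0 = 0"
      using g k(1) M k0 by (auto simp: m_def t_def subspace_diff subspace_scale)
    have "inner g m = 0" using g m by (auto simp: range_mult_z_iff orthogonal_def)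
    moreover have "inner k m = 0" using eval[OF m(1)] m(2) by simp
    ultimately have "inner m m = 0" by (subst (1) m_def) (simp add: inner_diff_left)
    then have g_eq: "g = t *\<^sub>R k" by (simp add: m_def)
    have "t > 0" using g k0 by (simp add: t_def fun_of_0)
    moreover have "\<bar>t\<bar> * norm k = 1" using g g_eq by simp
    ultimately have "t = inverse (norm k)" using \<open>k \<noteq> 0\<close> by (simp add: field_simps)
    then show "g = k /\<^sub>R norm k" using g_eq by simp
  qed
qed

text \<open>Some multiple of \<open>g\<close> agrees with \<open>f\<close> at \<open>0\<close>.  The difference is then orthogonal to \<open>g\<close>, so the
  factor has to be \<open>inner f g\<close>.\<close>

lemma extremal_remainder:
  assumes M: "subspace M" and g: "g \<in> M" "norm g = 1" "\<And>f. f \<in> M \<Longrightarrow> taylor f 0 = 0 \<Longrightarrow> inner g f = 0"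
    "taylor g 0 > 0" and f: "f \<in> M"
  shows "taylor (f - inner f g *\<^sub>R g) 0 = 0"
proof -
  define t where "t = taylor f 0 / taylor g 0"
  have "inner g (f - t *\<^sub>R g) = 0"
    using g M f by (intro g(3)) (auto simp: t_def subspace_diff subspace_scale)
  then have "inner f g = t" using g(2) by (simp add: inner_diff_right norm_eq_1 inner_commute)
  then show ?thesis using g(4) by (simp add: t_def)
qed

lemma almost_invariant_of_admits_defect:
  assumes "admits_defect M (span {e})" "f \<in> M" "taylor f 0 = 0"
  shows "\<exists>m\<in>M. \<exists>c. backward_shift f = m + c *\<^sub>R e"
proof -
  have "backward_shift f \<in> {m + f | m f. m \<in> M \<and> f \<in> span {e}}"
    using assms(1) unfolding admits_defect_def
    by (elim conjE, elim subsetD) (use assms in \<open>simp add: range_mult_z_iff\<close>)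
  then show ?thesis by (auto simp: span_singleton)
qed

theorem theorem4p3:
  fixes M :: "real_hardy set" and e :: real_hardy
  assumes "subspace M" and "closed M" and "M \<noteq> {0}"
    and "nearly_invariant M" and "defect M = 1"
    and "is_defect_space M (span {e})" and "norm e = 1"
  shows
    "((\<exists>f\<in>M. fun_of f 0 \<noteq> 0) \<longrightarrow>
       (\<exists>!g. g \<in> M \<and> norm g = 1 \<and> (\<forall>f \<in> M \<inter> range mult_z. orthogonal g f) \<and>
             fun_of g 0 \<in> \<real> \<and> Re (fun_of g 0) > 0) \<and>
       (\<forall>g. g \<in> M \<and> norm g = 1 \<and> (\<forall>f \<in> M \<inter> range mult_z. orthogonal g f) \<and>
             fun_of g 0 \<in> \<real> \<and> Re (fun_of g 0) > 0 \<longrightarrow>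
         (\<exists>N :: (real_hardy \<times> real_hardy) set.
            subspace N \<and> closed N \<and>
            map_prod backward_shift backward_shift ` N \<subseteq> N \<and>
            fun_of ` M =
              {(\<lambda>z\<in>unit_disc. fun_of g z * fun_of h z + z * fun_of h1 z * fun_of e z) | h h1.
                 (h, h1) \<in> N} \<and>
            (\<forall>f h h1. f \<in> M \<and> (h, h1) \<in> N \<and>
               fun_of f =
                 (\<lambda>z\<in>unit_disc. fun_of g z * fun_of h z + z * fun_of h1 z * fun_of e z) \<longrightarrow>
               (norm f)\<^sup>2 = (norm h)\<^sup>2 + (norm h1)\<^sup>2)))) \<and>
     ((\<forall>f\<in>M. fun_of f 0 = 0) \<longrightarrow>
       (\<exists>N :: real_hardy set.
          subspace N \<and> closed N \<and> backward_shift ` N \<subseteq> N \<and>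
          fun_of ` M = {(\<lambda>z\<in>unit_disc. z * fun_of h1 z * fun_of e z) | h1. h1 \<in> N} \<and>
          (\<forall>f h1. f \<in> M \<and> h1 \<in> N \<and>
             fun_of f = (\<lambda>z\<in>unit_disc. z * fun_of h1 z * fun_of e z) \<longrightarrow>
             norm f = norm h1)))"
proof (intro conjI impI)
  have defect: "admits_defect M (span {e})" using assms(6) by (simp add: is_defect_space_def)
  have e_ortho: "inner f e = 0" if "f \<in> M" for f
    using defect that by (auto simp: admits_defect_def orthogonal_def span_base)
  note almost_invariant = almost_invariant_of_admits_defect[OF defect]
  {
    assume "\<exists>f\<in>M. fun_of f 0 \<noteq> 0"
    then obtain f0 where "f0 \<in> M" "taylor f0 0 \<noteq> 0" by (auto simp: fun_of_0)
    then show "\<exists>!g. g \<in> M \<and> norm g = 1 \<and> (\<forall>f \<in> M \<inter> range mult_z. orthogonal g f) \<and>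
        fun_of g 0 \<in> \<real> \<and> Re (fun_of g 0) > 0"
      by (rule extremal_function[OF assms(1,2)])
  next
    show "\<forall>g. g \<in> M \<and> norm g = 1 \<and> (\<forall>f \<in> M \<inter> range mult_z. orthogonal g f) \<and>
        fun_of g 0 \<in> \<real> \<and> Re (fun_of g 0) > 0 \<longrightarrow>
      (\<exists>N :: (real_hardy \<times> real_hardy) set.
        subspace N \<and> closed N \<and> map_prod backward_shift backward_shift ` N \<subseteq> N \<and>
        fun_of ` M =
          {(\<lambda>z\<in>unit_disc. fun_of g z * fun_of h z + z * fun_of h1 z * fun_of e z) | h h1.
             (h, h1) \<in> N} \<and>
        (\<forall>f h h1. f \<in> M \<and> (h, h1) \<in> N \<and>
           fun_of f =
             (\<lambda>z\<in>unit_disc. fun_of g z * fun_of h z + z * fun_of h1 z * fun_of e z) \<longrightarrow>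
           (norm f)\<^sup>2 = (norm h)\<^sup>2 + (norm h1)\<^sup>2))"
    proof (intro allI impI)
      fix g
      assume g: "g \<in> M \<and> norm g = 1 \<and> (\<forall>f \<in> M \<inter> range mult_z. orthogonal g f) \<and>
        fun_of g 0 \<in> \<real> \<and> Re (fun_of g 0) > 0"
      interpret defect_one_frame M g e
      proof
        fix f assume "f \<in> M"
        then show "taylor (f - inner f g *\<^sub>R g) 0 = 0"
          using g by (intro extremal_remainder[OF assms(1)])
            (auto simp: range_mult_z_iff orthogonal_def fun_of_0)
      qed (use g assms e_ortho almost_invariant in auto)
      show "\<exists>N. subspace N \<and> closed N \<and> map_prod backward_shift backward_shift ` N \<subseteq> N \<and>
        fun_of ` M =
          {(\<lambda>z\<in>unit_disc. fun_of g z * fun_of h z + z * fun_of h1 z * fun_of e z) | h h1.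
             (h, h1) \<in> N} \<and>
        (\<forall>f h h1. f \<in> M \<and> (h, h1) \<in> N \<and>
           fun_of f =
             (\<lambda>z\<in>unit_disc. fun_of g z * fun_of h z + z * fun_of h1 z * fun_of e z) \<longrightarrow>
           (norm f)\<^sup>2 = (norm h)\<^sup>2 + (norm h1)\<^sup>2)"
        using subspace_pair_model closed_pair_model pair_model_invariant fun_of_image_M pair_model_norm
        by (intro exI[of _ pair_model]) blast
    qed
  next
    assume vanish: "\<forall>f\<in>M. fun_of f 0 = 0"
    interpret defect_one_frame M 0 e
      by standard (use vanish assms e_ortho almost_invariant in \<open>auto simp: fun_of_0 subspace_0\<close>)
    show "\<exists>N. subspace N \<and> closed N \<and> backward_shift ` N \<subseteq> N \<and>
        fun_of ` M = {(\<lambda>z\<in>unit_disc. z * fun_of h1 z * fun_of e z) | h1. h1 \<in> N} \<and>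
        (\<forall>f h1. f \<in> M \<and> h1 \<in> N \<and>
           fun_of f = (\<lambda>z\<in>unit_disc. z * fun_of h1 z * fun_of e z) \<longrightarrow> norm f = norm h1)"
      using subspace_single_model closed_single_model single_model_invariant fun_of_image_M1 single_model_norm
      by (intro exI[of _ single_model]) blast
  }
qed

end
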